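(* There exist distribution functions $F$, $F_1$, and $F_2$ on $\mathbb{R}$ such that $F=F_1*F_2$ and $F\in\boldsymbol{Q}\setminus\boldsymbol{I}$, but $F_1\notin\boldsymbol{Q}$ and $F_2\notin\boldsymbol{Q}$.
   Context: Distribution functions are distribution functions of probability laws on the real line $\mathbb{R}$, and $*$ denotes convolution of distribution functions (i.e. $F=F_1*F_2$ is the distribution function of the sum of two independent random variables with distribution functions $F_1$ and $F_2$; equivalently, the characteristic functions multiply). A distribution function $F$ is infinitely divisible if for every positive integer $n$ there exists a distribution function $F_{1/n}$ such that $F=(F_{1/n})^{*n}$ ($n$-fold convolution power). The class of all infinitely divisible distribution functions is denoted by $\boldsymbol{I}$. A distribution function $F$ is rational-infinitely divisible if there exist infinitely divisible distribution functions $H_1,H_2\in\boldsymbol{I}$ such that $H_1=F*H_2$. The class of all rational-infinitely divisible distribution functions is denoted by $\boldsymbol{Q}$; thus $\boldsymbol{I}\subset\boldsymbol{Q}$. *)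

theory Defs
  imports "HOL-Probability.Probability"
begin

definition distribution_function :: "(real \<Rightarrow> real) \<Rightarrow> bool" where
  "distribution_function F \<longleftrightarrow> (\<exists>M. real_distribution M \<and> F = cdf M)"

text \<open>
  For a distribution function \<open>F\<close>, the measure \<open>interval_measure F\<close> is the unique probability law
  on the line with distribution function \<open>F\<close> (see \<open>interval_measure_cdf\<close> below).  On functions that
  are not distribution functions, \<open>conv\<close> has no meaning.
\<close>

definition conv :: "(real \<Rightarrow> real) \<Rightarrow> (real \<Rightarrow> real) \<Rightarrow> real \<Rightarrow> real" where
  "conv F G = cdf (convolution (interval_measure F) (interval_measure G))"

text \<open>The zeroth power is the unit of convolution, the distribution function of the point mass at 0.\<close>

primrec conv_power :: "(real \<Rightarrow> real) \<Rightarrow> nat \<Rightarrow> real \<Rightarrow> real" where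
  "conv_power F 0 = cdf (return borel 0)"
| "conv_power F (Suc n) = conv F (conv_power F n)"

definition inf_div :: "(real \<Rightarrow> real) set" where
  "inf_div = {F. distribution_function F \<and>
     (\<forall>n\<ge>1. \<exists>G. distribution_function G \<and> F = conv_power G n)}"

definition rat_inf_div :: "(real \<Rightarrow> real) set" where
  "rat_inf_div = {F. distribution_function F \<and>
     (\<exists>H1\<in>inf_div. \<exists>H2\<in>inf_div. H1 = conv F H2)}"

lemma interval_measure_cdf:
  assumes "real_distribution M"
  shows "interval_measure (cdf M) = M"
proof -
  interpret M: real_distribution M by fact
  show ?thesis
  proof (rule cdf_unique)
    show "real_distribution (interval_measure (cdf M))"
      by (rule real_distribution_interval_measure)
        (auto intro: M.cdf_nondecreasing M.cdf_is_right_cont M.cdf_lim_at_bot M.cdf_lim_at_top_prob)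
    show "cdf (interval_measure (cdf M)) = cdf M"
      by (rule cdf_interval_measure)
        (auto intro: M.cdf_nondecreasing M.cdf_is_right_cont M.cdf_lim_at_bot)
  qed fact
qed

lemma distribution_function_iff:
  "distribution_function F \<longleftrightarrow>
     mono F \<and> (\<forall>a. continuous (at_right a) F) \<and> (F \<longlongrightarrow> 0) at_bot \<and> (F \<longlongrightarrow> 1) at_top"
  (is "_ \<longleftrightarrow> ?R")
proof
  assume "distribution_function F"
  then obtain M where "real_distribution M" and F: "F = cdf M"
    unfolding distribution_function_def by blast
  then interpret M: real_distribution M by simp
  show ?R
    unfolding F by (auto intro!: monoI M.cdf_nondecreasing M.cdf_is_right_cont
        M.cdf_lim_at_bot M.cdf_lim_at_top_prob)
next
  assume ?R
  then have "real_distribution (interval_measure F)" "cdf (interval_measure F) = F"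
    by (auto intro!: real_distribution_interval_measure cdf_interval_measure dest: monoD)
  then show "distribution_function F"
    unfolding distribution_function_def by metis
qed

lemma real_distribution_convolution:
  assumes "real_distribution M" "real_distribution N"
  shows "real_distribution (convolution M N)"
proof -
  interpret M: real_distribution M by fact
  interpret N: real_distribution N by fact
  interpret P: pair_prob_space M N ..
  show ?thesis
    unfolding convolution_def by (rule P.real_distribution_distr) measurable
qed

lemma conv_cdf:
  assumes "real_distribution M" "real_distribution N"
  shows "conv (cdf M) (cdf N) = cdf (convolution M N)"
  using assms by (simp add: conv_def interval_measure_cdf)

lemma distribution_function_conv:
  assumes "distribution_function F" "distribution_function G"
  shows "distribution_function (conv F G)"
  using assms unfolding distribution_function_def
  by (metis conv_cdf real_distribution_convolution)

lemma conv_power_1: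
  assumes "distribution_function F"
  shows "conv_power F 1 = F"
proof -
  obtain M where M: "real_distribution M" and F: "F = cdf M"
    using assms unfolding distribution_function_def by blast
  interpret M: real_distribution M by fact
  have D: "real_distribution (return borel 0)"
    by (intro real_distribution.intro real_distribution_axioms.intro prob_space_return) auto
  then interpret D: real_distribution "return borel (0::real)" .
  have "emeasure (convolution M (return borel 0)) A = emeasure M A" if A: "A \<in> sets borel" for A
  proof -
    have "emeasure (convolution M (return borel 0)) A
        = (\<integral>\<^sup>+x. \<integral>\<^sup>+y. indicator A (x + y) \<partial>return borel 0 \<partial>M)"
      using A by (intro convolution_emeasure')
        (auto simp: M.finite_measure_axioms D.finite_measure_axioms)
    also have "\<dots> = (\<integral>\<^sup>+x. indicator A x \<partial>M)"
      using A by (intro nn_integral_cong) (subst nn_integral_return, auto)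
    finally show ?thesis using A by simp
  qed
  then have "convolution M (return borel 0) = M"
    by (intro measure_eqI) auto
  then show ?thesis
    using conv_cdf[OF M D] F by simp
qed

end

(* Let N be large and pi / 4 < c < 1.  The function
     f(t) = exp (- |t| + c N (1 - cos (t / N)) + i theta(t)),
   where theta is odd and theta(t) = max 0 (t - N) ^ 3 for t > 0, is a small perturbation of the
   Cauchy characteristic function exp (- |t|), so small that its inverse Fourier transform stays
   positive; hence f is a characteristic function, say of F1.  Let F2 be the reflection of F1.
   The phases cancel in F = F1 * F2, whose characteristic function
   exp (- 2 |t| + 2 c N (1 - cos (t / N))), multiplied by that of a symmetrized Poisson law,
   is that of a Cauchy law.  So F is in Q.  The continuous logarithm phi of an infinitely divisible
   characteristic function satisfies Re (phi (2 t)) >= 4 Re (phi t), which fails for F at t = pi N,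
   and Im (phi (2 ^ k)) = O(4 ^ k).  By the latter theta (2 ^ k) would be O(4 ^ k) if F1 or F2
   were in Q, but it grows like 8 ^ k. *)
theory Submission
  imports Defs "HOL-Real_Asymp.Real_Asymp"
begin

section \<open>Logarithms of infinitely divisible characteristic functions\<close>

text \<open>The Cauchy density is a multiple of 1 / (1 + x^2), so a perturbation whose transform
  stays below that weight keeps it positive. Two integrations by parts give such a bound for a
  decaying half-line perturbation that is C^2 and vanishes with its first derivative at 0. The cube
  is the least truncated integer power that is C^2, and also the least that outgrows 4 ^ k. Starting
  theta at N instead of 0 makes the phase vanish pointwise as N grows; the cosine term vanishes
  pointwise too, yet at t = pi N it is still comparable with |t|. The window for c: at t = pi N the
  doubling inequality for F reads 4 c <= pi, so c > pi / 4 breaks it, while N (1 - cos (t / N)) <=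
  |t| and c < 1 leave the decay exp (- (1 - c) |t|). The 4 ^ k barrier passes from I to Q because
  the continuous logarithm of a law in Q is a difference of two logarithms that obey it. The
  inequalities for phi do not come from a Levy-Khintchine representation: they are limits of
  elementary inequalities for the characteristic functions of n-th roots.\<close>

lemma char_convolution:
  assumes "real_distribution M" "real_distribution N"
  shows "char (convolution M N) t = char M t * char N t"
proof -
  interpret M: real_distribution M by fact
  interpret N: real_distribution N by fact
  interpret P: pair_prob_space M N ..
  have int: "integrable (M \<Otimes>\<^sub>M N) (\<lambda>z. iexp (t * (fst z + snd z)))"
    by (rule P.integrable_const_bound[where B = 1]) auto
  have "char (convolution M N) t = (CLINT z|M \<Otimes>\<^sub>M N. iexp (t * (fst z + snd z)))"
    unfolding char_def convolution_def by (subst integral_distr) (auto simp: case_prod_beta)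
  also have "\<dots> = (CLINT x|M. CLINT y|N. iexp (t * (x + y)))"
    using P.integral_fst'[OF int] by simp
  also have "\<dots> = (CLINT x|M. CLINT y|N. iexp (t * x) * iexp (t * y))"
    by (simp add: exp_add[symmetric] algebra_simps)
  finally show ?thesis
    by (simp add: char_def)
qed

lemma real_distribution_distr:
  assumes "real_distribution M" "f \<in> borel_measurable borel"
  shows "real_distribution (distr M borel f)"
proof -
  interpret M: real_distribution M by fact
  show ?thesis using assms(2) by (intro M.real_distribution_distr) simp
qed

lemma char_distr_scale:
  assumes "real_distribution M"
  shows "char (distr M borel (\<lambda>x. a * x)) t = char M (a * t)"
proof -
  interpret M: real_distribution M by fact
  show ?thesis
    unfolding char_def by (subst integral_distr) (auto simp: algebra_simps)
qed

lemma char_minus: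
  assumes "real_distribution M"
  shows "char M (- t) = cnj (char M t)"
proof -
  interpret M: real_distribution M by fact
  have "char M (- t) = (CLINT x|M. cnj (iexp (t * x)))"
    unfolding char_def by (intro Bochner_Integration.integral_cong) (simp_all add: exp_cnj)
  also have "\<dots> = cnj (char M t)"
    unfolding char_def by (rule Bochner_Integration.integral_cnj)
  finally show ?thesis .
qed

lemma char_reflect:
  assumes "real_distribution M"
  shows "char (distr M borel uminus) t = cnj (char M t)"
  using char_distr_scale[OF assms, of "-1" t] char_minus[OF assms, of t]
  by simp

lemma real_distribution_return: "real_distribution (return borel (a::real))"
  by (intro real_distribution.intro real_distribution_axioms.intro prob_space_return) auto

lemma char_return: "char (return borel a) t = iexp (t * a)"
  unfolding char_def by (subst integral_return) auto

lemma conv_power_cdf: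
  assumes N: "real_distribution N"
  shows "\<exists>M. real_distribution M \<and> conv_power (cdf N) n = cdf M \<and> (\<forall>t. char M t = char N t ^ n)"
proof (induction n)
  case 0
  show ?case
    using real_distribution_return[of 0] by (auto simp: char_return)
next
  case (Suc n)
  then obtain M where M: "real_distribution M" "conv_power (cdf N) n = cdf M"
    "\<And>t. char M t = char N t ^ n"
    by blast
  then show ?case
    using N by (intro exI[of _ "convolution N M"])
      (auto simp: conv_cdf char_convolution intro: real_distribution_convolution)
qed

text \<open>Uniqueness of characteristic functions turns convolution roots of distribution functions
  into pointwise roots of characteristic functions; everything below works with the latter.\<close>

lemma cdf_inf_div_iff:
  assumes M: "real_distribution M"
  shows "cdf M \<in> inf_div \<longleftrightarrow> (\<forall>n\<ge>1. \<exists>N. real_distribution N \<and> (\<forall>t. char M t = char N t ^ n))"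
    (is "?L \<longleftrightarrow> ?R")
proof
  assume ?L
  show ?R
  proof (intro allI impI)
    fix n :: nat assume "n \<ge> 1"
    with \<open>?L\<close> obtain N where N: "real_distribution N" "cdf M = conv_power (cdf N) n"
      unfolding inf_div_def distribution_function_def by blast
    obtain M' where M': "real_distribution M'" "conv_power (cdf N) n = cdf M'"
      "\<And>t. char M' t = char N t ^ n"
      using conv_power_cdf[OF N(1)] by blast
    with N have "M = M'" using M cdf_unique by metis
    with M' N show "\<exists>N. real_distribution N \<and> (\<forall>t. char M t = char N t ^ n)" by auto
  qed
next
  assume R: ?R
  have "\<exists>G. distribution_function G \<and> cdf M = conv_power G n" if n: "n \<ge> 1" for n
  proof -
    from R n obtain N where N: "real_distribution N" "\<And>t. char M t = char N t ^ n" by blast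
    obtain M' where M': "real_distribution M'" "conv_power (cdf N) n = cdf M'"
      "\<And>t. char M' t = char N t ^ n"
      using conv_power_cdf[OF N(1)] by blast
    have "M = M'" using M M' N by (intro Levy_uniqueness) auto
    with M' N show ?thesis unfolding distribution_function_def by metis
  qed
  then show ?L
    using M by (auto simp: inf_div_def distribution_function_def)
qed

section \<open>Doubling inequalities and continuous logarithms\<close>

lemma char_Re_Im:
  assumes "real_distribution M"
  shows "integrable M (\<lambda>x. cos (t * x))" "integrable M (\<lambda>x. sin (t * x))"
    "Re (char M t) = (\<integral>x. cos (t * x) \<partial>M)" "Im (char M t) = (\<integral>x. sin (t * x) \<partial>M)"
proof -
  interpret M: real_distribution M by fact
  have int: "integrable M (\<lambda>x. iexp (t * x))"
    using M.integrable_iexp[of "\<lambda>x. complex_of_real (t * x)"] by simp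
  show "integrable M (\<lambda>x. cos (t * x))" "integrable M (\<lambda>x. sin (t * x))"
    using integrable_Re[OF int] integrable_Im[OF int] by (simp_all add: Re_exp Im_exp)
  show "Re (char M t) = (\<integral>x. cos (t * x) \<partial>M)" "Im (char M t) = (\<integral>x. sin (t * x) \<partial>M)"
    unfolding char_def integral_Re[OF int, symmetric] integral_Im[OF int, symmetric]
    by (simp_all add: Re_exp Im_exp del: integral_Re integral_Im)
qed

text \<open>Both parts integrate a trigonometric fact with u = t * x: 4 (1 - cos u) - (1 - cos 2u) =
  2 (1 - cos u)^2, and sin 2u - 2 sin u = - 2 sin u (1 - cos u). The bounds are linear in 1 - Re and
  Im, so they survive the scaling limit in \<open>inf_div_log\<close>.\<close>

lemma char_double:
  assumes M: "real_distribution M"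
  shows "1 - Re (char M (2 * t)) \<le> 4 * (1 - Re (char M t))"
    and "\<bar>Im (char M (2 * t)) - 2 * Im (char M t)\<bar> \<le> 2 * (1 - Re (char M t))"
proof -
  interpret M: real_distribution M by fact
  note [simp] = char_Re_Im[OF M]
  have [simp]: "measure M UNIV = 1"
    using M.prob_space by simp
  have int2: "integrable M (\<lambda>x. cos (2 * (t * x)))" "integrable M (\<lambda>x. sin (2 * (t * x)))"
    using char_Re_Im(1,2)[OF M, of "2 * t"] by (simp_all add: mult.assoc)
  have eq2: "Re (char M (2 * t)) = (\<integral>x. cos (2 * (t * x)) \<partial>M)"
    "Im (char M (2 * t)) = (\<integral>x. sin (2 * (t * x)) \<partial>M)"
    by (simp_all add: mult.assoc)
  have "(\<integral>x. 1 - cos (2 * (t * x)) \<partial>M) \<le> (\<integral>x. 4 * (1 - cos (t * x)) \<partial>M)"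
  proof (rule integral_mono)
    show "1 - cos (2 * (t * x)) \<le> 4 * (1 - cos (t * x))" for x
      using zero_le_power2[of "1 - cos (t * x)"]
      unfolding cos_double_cos by (simp add: power2_eq_square algebra_simps)
  qed (use int2 in auto)
  then show "1 - Re (char M (2 * t)) \<le> 4 * (1 - Re (char M t))"
    using int2 by (simp add: eq2 mult.assoc)
  have b: "\<bar>sin (2 * (t * x)) - 2 * sin (t * x)\<bar> \<le> 2 * (1 - cos (t * x))" for x
  proof -
    have "\<bar>sin (2 * (t * x)) - 2 * sin (t * x)\<bar> = 2 * \<bar>sin (t * x)\<bar> * (1 - cos (t * x))"
    proof -
      have "sin (2 * (t * x)) - 2 * sin (t * x) = - (2 * sin (t * x) * (1 - cos (t * x)))"
        unfolding sin_double by (simp add: algebra_simps)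
      then show ?thesis
        by (simp add: abs_mult)
    qed
    also have "\<dots> \<le> 2 * 1 * (1 - cos (t * x))"
      by (intro mult_right_mono mult_left_mono) auto
    finally show ?thesis by simp
  qed
  have "\<bar>\<integral>x. sin (2 * (t * x)) - 2 * sin (t * x) \<partial>M\<bar> \<le> (\<integral>x. \<bar>sin (2 * (t * x)) - 2 * sin (t * x)\<bar> \<partial>M)"
    by (rule integral_abs_bound)
  also have "\<dots> \<le> (\<integral>x. 2 * (1 - cos (t * x)) \<partial>M)"
    by (rule integral_mono) (use int2 b in auto)
  finally show "\<bar>Im (char M (2 * t)) - 2 * Im (char M t)\<bar> \<le> 2 * (1 - Re (char M t))"
    using int2 by (simp add: eq2 mult.assoc)
qed

text \<open>Symmetrization: the squared modulus is itself a characteristic function, that of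
  \<open>M\<close> convolved with its reflection, so the first doubling inequality applies to
  it.\<close>

lemma norm_char_double:
  assumes M: "real_distribution M"
  shows "1 - norm (char M (2 * t)) ^ 2 \<le> 4 * (1 - norm (char M t) ^ 2)"
proof -
  let ?R = "distr M borel uminus"
  have R: "real_distribution ?R" by (rule real_distribution_distr[OF M]) simp
  have "Re (char (convolution M ?R) t) = norm (char M t) ^ 2" for t
    by (simp add: char_convolution[OF M R] char_reflect[OF M] complex_mult_cnj cmod_power2)
  then show ?thesis
    using char_double(1)[OF real_distribution_convolution[OF M R], of t] by simp
qed

text \<open>If the value at s is nonzero, a root of high order has squared modulus above 3/4 there.
  Since 4 (1 - 3/4) = 1, the doubling inequality keeps that root nonzero at 2 s. Hence a zero at t
  would force zeros at all t / 2 ^ k, against continuity at 0.\<close>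

lemma inf_div_char_nonzero:
  assumes M: "real_distribution M" and "cdf M \<in> inf_div"
  shows "char M t \<noteq> 0"
proof
  assume 0: "char M t = 0"
  interpret M: real_distribution M by fact
  have half: "char M (2 * s) \<noteq> 0" if s: "char M s \<noteq> 0" for s
  proof -
    have "(\<lambda>n. root n (norm (char M s))) \<longlonglongrightarrow> 1"
      using s by (intro LIMSEQ_root_const) simp
    then have "(\<lambda>n. root n (norm (char M s)) ^ 2) \<longlonglongrightarrow> 1 ^ 2"
      by (intro tendsto_intros)
    then have "\<forall>\<^sub>F n in sequentially. root n (norm (char M s)) ^ 2 > 3 / 4"
      by (rule order_tendstoD) simp
    then have "\<forall>\<^sub>F n in sequentially. root n (norm (char M s)) ^ 2 > 3 / 4 \<and> n \<ge> 1"
      by (intro eventually_conj eventually_ge_at_top)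
    then obtain n where n: "root n (norm (char M s)) ^ 2 > 3 / 4" "n \<ge> 1"
      by (auto simp: eventually_sequentially)
    obtain N where N: "real_distribution N" "\<And>t. char M t = char N t ^ n"
      using assms n(2) cdf_inf_div_iff by blast
    have "norm (char N s) ^ 2 > 3 / 4"
      using n by (simp add: N(2) norm_power real_root_power_cancel)
    then have "4 * (1 - norm (char N s) ^ 2) < 1"
      by (simp add: field_simps)
    then have "1 - norm (char N (2 * s)) ^ 2 < 1"
      by (rule le_less_trans[OF norm_char_double[OF N(1)]])
    then show ?thesis
      by (auto simp: N(2))
  qed
  have z: "char M (t / 2 ^ k) = 0" for k
  proof (induction k)
    case (Suc k)
    with half[of "t / 2 ^ Suc k"] show ?case by (auto simp: field_simps)
  qed (simp add: 0)
  have "(\<lambda>k. t / 2 ^ k) \<longlonglongrightarrow> 0"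
    by real_asymp
  then have "(\<lambda>k. char M (t / 2 ^ k)) \<longlonglongrightarrow> char M 0"
    by (rule isCont_tendsto_compose[OF M.isCont_char])
  then show False
    by (simp add: z M.char_zero LIMSEQ_const_iff)
qed

text \<open>The difference is continuous on a connected set with values in the discrete set of
  integer multiples of 2 pi i, hence constant.\<close>

lemma continuous_log_unique:
  fixes f g :: "real \<Rightarrow> complex"
  assumes "continuous_on UNIV f" "continuous_on UNIV g" "\<And>t. exp (f t) = exp (g t)" "f 0 = g 0"
  shows "f t = g t"
proof -
  have "(\<lambda>t. f t - g t) constant_on UNIV"
  proof (rule continuous_discrete_range_constant)
    show "continuous_on UNIV (\<lambda>t. f t - g t)"
      using assms by (intro continuous_intros)
    fix x :: real
    have "2 * pi \<le> cmod (f y - g y - (f x - g x))" if ne: "f y - g y \<noteq> f x - g x" for y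
    proof -
      obtain k l :: int where "f y = g y + (of_int (2 * k) * pi) * \<i>"
        "f x = g x + (of_int (2 * l) * pi) * \<i>"
        using assms(3)[of x] assms(3)[of y] unfolding exp_eq by blast
      then have eq: "f y - g y - (f x - g x) = of_real (2 * of_int (k - l) * pi) * \<i>"
        by (simp add: algebra_simps)
      with ne have "k \<noteq> l" by auto
      then have "1 \<le> \<bar>real_of_int (k - l)\<bar>" by linarith
      then show ?thesis
        unfolding eq norm_mult norm_of_real by (simp add: abs_mult)
    qed
    then show "\<exists>e>0. \<forall>y. y \<in> UNIV \<and> f y - g y \<noteq> f x - g x \<longrightarrow> e \<le> cmod (f y - g y - (f x - g x))"
      by (intro exI[of _ "2 * pi"]) auto
  qed simp
  then obtain c where "\<And>t. f t - g t = c"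
    unfolding constant_on_def by auto
  from this[of t] this[of 0] assms(4) show ?thesis by simp
qed

lemma continuous_log_exists:
  assumes "real_distribution M" "\<And>t. char M t \<noteq> 0"
  obtains \<phi> where "continuous_on UNIV \<phi>" "\<phi> 0 = 0" "\<And>t. char M t = exp (\<phi> t)"
proof -
  interpret M: real_distribution M by fact
  have "continuous_on UNIV (char M)"
    using M.isCont_char by (simp add: continuous_at_imp_continuous_on)
  then obtain g where g: "continuous_on UNIV g" "\<And>t. char M t = exp (g t)"
    using continuous_logarithm_on_contractible[of UNIV "char M"] assms(2)
    by (auto intro: convex_imp_contractible)
  show thesis
  proof
    show "continuous_on UNIV (\<lambda>t. g t - g 0)"
      using g by (intro continuous_intros)
    show "char M t = exp (g t - g 0)" for t
      using g(2)[of 0] g(2)[of t] by (simp add: exp_diff M.char_zero)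
  qed simp
qed

text \<open>By uniqueness of continuous logarithms, the root of order \<open>Suc n\<close> has
  logarithm \<open>\<phi> t / Suc n\<close>. Multiplying the inequalities of
  \<open>char_double\<close> for this root by \<open>Suc n\<close> and letting n grow replaces 1 -
  char by \<open>- \<phi>\<close>.\<close>

lemma inf_div_log:
  assumes M: "real_distribution M" and id: "cdf M \<in> inf_div"
    and \<phi>: "continuous_on UNIV \<phi>" "\<phi> 0 = 0" "\<And>t. char M t = exp (\<phi> t)"
  shows "4 * Re (\<phi> t) \<le> Re (\<phi> (2 * t))"
    and "\<bar>Im (\<phi> (2 * t)) - 2 * Im (\<phi> t)\<bar> \<le> - 2 * Re (\<phi> t)"
proof -
  have root: "\<exists>N. real_distribution N \<and> (\<forall>t. char N t = exp (\<phi> t / Suc n))" for n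
  proof -
    obtain N where N: "real_distribution N" "\<And>t. char M t = char N t ^ Suc n"
      using id cdf_inf_div_iff[OF M] by (metis le_add1 plus_1_eq_Suc)
    have "char N t \<noteq> 0" for t
      using N(2)[of t] \<phi>(3)[of t] by (metis exp_not_eq_zero power_0_Suc)
    then obtain \<psi> where \<psi>: "continuous_on UNIV \<psi>" "\<psi> 0 = 0" "\<And>t. char N t = exp (\<psi> t)"
      using continuous_log_exists[OF N(1)] by blast
    have "\<phi> t = of_nat (Suc n) * \<psi> t" for t
    proof (rule continuous_log_unique[where f = \<phi>])
      show "continuous_on UNIV (\<lambda>t. of_nat (Suc n) * \<psi> t)"
        using \<psi> by (intro continuous_intros)
      show "exp (\<phi> t) = exp (of_nat (Suc n) * \<psi> t)" for t
        using N(2)[of t] \<phi>(3)[of t] \<psi>(3)[of t] exp_of_nat_mult[of "Suc n" "\<psi> t"] by simp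
    qed (use \<phi> \<psi> in auto)
    then have "\<psi> t = \<phi> t / Suc n" for t
      by (simp add: field_simps del: of_nat_Suc)
    with N(1) \<psi>(3) show ?thesis by auto
  qed
  then obtain N where N: "\<And>n. real_distribution (N n)" "\<And>n t. char (N n) t = exp (\<phi> t / Suc n)"
    by metis
  \<comment> \<open>This is the derivative of exp at 0 along the sequence
    \<open>\<phi> s / Suc n\<close>; the quotient needs nonzero increments, so
    \<open>\<phi> s = 0\<close> is split off.\<close>
  have lim: "(\<lambda>n. Suc n * (1 - char (N n) s)) \<longlonglongrightarrow> - \<phi> s" for s
  proof (cases "\<phi> s = 0")
    case False
    have "(\<lambda>n. \<phi> s / Suc n) \<longlonglongrightarrow> 0"
      by (intro tendsto_divide_0[OF tendsto_const] filterlim_compose[OF tendsto_of_nat] filterlim_Suc)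
    then have "filterlim (\<lambda>n. \<phi> s / Suc n) (at 0) sequentially"
      using False by (intro filterlim_atI) (auto simp del: of_nat_Suc)
    moreover have "((\<lambda>z::complex. (exp z - 1) / z) \<longlongrightarrow> 1) (at 0)"
      using DERIV_exp[of "0::complex"] by (simp add: has_field_derivative_iff)
    ultimately have "(\<lambda>n. (exp (\<phi> s / Suc n) - 1) / (\<phi> s / Suc n)) \<longlonglongrightarrow> 1"
      by (rule filterlim_compose[rotated])
    then have "(\<lambda>n. - \<phi> s * ((exp (\<phi> s / Suc n) - 1) / (\<phi> s / Suc n))) \<longlonglongrightarrow> - \<phi> s * 1"
      by (intro tendsto_intros)
    then show ?thesis
      using False by (simp add: N(2) divide_simps del: of_nat_Suc) (simp add: algebra_simps)
  qed (simp add: N(2))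
  have limRe: "(\<lambda>n. Suc n * (1 - Re (char (N n) s))) \<longlonglongrightarrow> - Re (\<phi> s)" for s
    using tendsto_Re[OF lim[of s]] by simp
  have limIm: "(\<lambda>n. Suc n * Im (char (N n) s)) \<longlonglongrightarrow> Im (\<phi> s)" for s
    using tendsto_minus[OF tendsto_Im[OF lim[of s]]] by simp
  have "- Re (\<phi> (2 * t)) \<le> 4 * (- Re (\<phi> t))"
  proof (rule LIMSEQ_le[OF limRe tendsto_mult_left[OF limRe]])
    show "\<exists>K. \<forall>n\<ge>K. Suc n * (1 - Re (char (N n) (2 * t))) \<le> 4 * (Suc n * (1 - Re (char (N n) t)))"
      using mult_left_mono[OF char_double(1)[OF N(1)], of "real (Suc n)" for n]
      by (simp add: algebra_simps)
  qed
  then show "4 * Re (\<phi> t) \<le> Re (\<phi> (2 * t))" by simp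
  have "\<bar>Im (\<phi> (2 * t)) - 2 * Im (\<phi> t)\<bar> \<le> 2 * (- Re (\<phi> t))"
  proof (rule LIMSEQ_le)
    show "(\<lambda>n. \<bar>Suc n * Im (char (N n) (2 * t)) - 2 * (Suc n * Im (char (N n) t))\<bar>)
        \<longlonglongrightarrow> \<bar>Im (\<phi> (2 * t)) - 2 * Im (\<phi> t)\<bar>"
      by (intro tendsto_intros limIm)
    show "(\<lambda>n. 2 * (Suc n * (1 - Re (char (N n) t)))) \<longlonglongrightarrow> 2 * (- Re (\<phi> t))"
      by (intro tendsto_intros limRe)
    have "\<bar>Suc n * Im (char (N n) (2 * t)) - 2 * (Suc n * Im (char (N n) t))\<bar>
        = Suc n * \<bar>Im (char (N n) (2 * t)) - 2 * Im (char (N n) t)\<bar>" for n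
    proof -
      have "Suc n * Im (char (N n) (2 * t)) - 2 * (Suc n * Im (char (N n) t))
          = Suc n * (Im (char (N n) (2 * t)) - 2 * Im (char (N n) t))"
        by (simp add: algebra_simps)
      then show ?thesis by (simp only: abs_mult abs_of_nat)
    qed
    then show "\<exists>K. \<forall>n\<ge>K. \<bar>Suc n * Im (char (N n) (2 * t)) - 2 * (Suc n * Im (char (N n) t))\<bar>
        \<le> 2 * (Suc n * (1 - Re (char (N n) t)))"
      using mult_left_mono[OF char_double(2)[OF N(1)], of "real (Suc n)" for n]
      by (simp only: mult.left_commute) auto
  qed
  then show "\<bar>Im (\<phi> (2 * t)) - 2 * Im (\<phi> t)\<bar> \<le> - 2 * Re (\<phi> t)" by simp
qed

section \<open>Functions with nonnegative inverse Fourier transform\<close>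

lemma integrable_std_normal_density_scale:
  assumes "d \<noteq> 0"
  shows "integrable lborel (\<lambda>x. std_normal_density (d * x))"
  using lborel_integrable_real_affine[of std_normal_density d 0] integrable_normal_density[of 1 0] assms
  by simp

text \<open>By Fubini and the self-duality of the Gaussian, damping the double transform of
  \<open>G\<close> amounts to averaging \<open>G\<close> over a normal law with mean t and standard
  deviation d. The identity holds before anything is known about integrability of the inner
  transform.\<close>

lemma gaussian_regularization:
  fixes G :: "real \<Rightarrow> complex" and d t :: real
  assumes int: "integrable lborel G" and d: "d > 0"
  shows "(CLBINT x. (CLBINT s. G s * iexp (- (s * x))) * iexp (t * x) * std_normal_density (d * x))
    = sqrt (2 * pi) * (CLBINT z. G (t + d * z) * std_normal_density z)"
proof -
  have [measurable]: "G \<in> borel_measurable borel"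
    using int by auto
  have char_normal: "(CLBINT z. iexp (y * z) * std_normal_density z) = exp (- y\<^sup>2 / 2)" for y
    using fun_cong[OF char_std_normal_distribution, of y]
    by (simp add: char_def integral_density scaleR_conv_of_real mult.commute)
  \<comment> \<open>Substitution z = d * x in the characteristic function of the standard normal
    law.\<close>
  have inner: "(CLBINT x. iexp (y * x) * std_normal_density (d * x))
      = sqrt (2 * pi) * std_normal_density (y / d) / d" for y
  proof -
    have "(CLBINT z. iexp (y / d * z) * std_normal_density z)
        = \<bar>d\<bar> *\<^sub>R (CLBINT x. iexp (y / d * (0 + d * x)) * std_normal_density (0 + d * x))"
      using d by (intro lborel_integral_real_affine) simp
    also have "\<dots> = d * (CLBINT x. iexp (y * x) * std_normal_density (d * x))"
      using d by (simp add: scaleR_conv_of_real)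
    finally have "d * (CLBINT x. iexp (y * x) * std_normal_density (d * x)) = exp (- (y / d)\<^sup>2 / 2)"
      unfolding char_normal by (rule sym)
    then show ?thesis
      using d by (simp add: std_normal_density_def divide_simps) (simp add: mult.commute)
  qed
  have intw: "integrable lborel (\<lambda>x. std_normal_density (d * x))"
    using d by (intro integrable_std_normal_density_scale) simp
  let ?f = "\<lambda>x s. G s * iexp ((t - s) * x) * std_normal_density (d * x)"
  have nf: "norm (?f x s) = norm (G s) * std_normal_density (d * x)" for x s
    by (simp add: norm_mult)
  have F: "integrable (lborel \<Otimes>\<^sub>M lborel) (case_prod ?f)"
  proof (rule lborel_pair.Fubini_integrable)
    show "case_prod ?f \<in> borel_measurable (lborel \<Otimes>\<^sub>M lborel)"
      by measurable
    show "integrable lborel (\<lambda>x. LBINT y. norm (case (x, y) of (x, s) \<Rightarrow> ?f x s))"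
      unfolding case_prod_conv nf using int intw by simp
    show "AE x in lborel. integrable lborel (\<lambda>y. case (x, y) of (x, s) \<Rightarrow> ?f x s)"
    proof (intro AE_I2)
      fix x :: real
      show "integrable lborel (\<lambda>y. case (x, y) of (x, s) \<Rightarrow> ?f x s)"
        by (rule Bochner_Integration.integrable_bound[of _ "\<lambda>s. norm (G s) * std_normal_density (d * x)"])
          (use int in \<open>auto simp: nf norm_mult\<close>)
    qed
  qed
  have "(CLBINT x. (CLBINT s. G s * iexp (- (s * x))) * iexp (t * x) * std_normal_density (d * x))
      = (CLBINT x. CLBINT s. ?f x s)"
  proof (intro Bochner_Integration.integral_cong refl)
    fix x :: real
    have "?f x s = G s * iexp (- (s * x)) * (iexp (t * x) * std_normal_density (d * x))" for s
      by (simp add: mult.assoc flip: exp_add mult.assoc[of "exp _" "exp _"]) (simp add: algebra_simps)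
    then have "(CLBINT s. ?f x s)
        = (CLBINT s. G s * iexp (- (s * x)) * (iexp (t * x) * std_normal_density (d * x)))"
      by (simp only:)
    also have "\<dots> = (CLBINT s. G s * iexp (- (s * x))) * (iexp (t * x) * std_normal_density (d * x))"
      by (rule integral_mult_left_zero)
    finally show "(CLBINT s. G s * iexp (- (s * x))) * iexp (t * x) * std_normal_density (d * x)
        = (CLBINT s. ?f x s)"
      by (simp only: mult.assoc)
  qed
  also have "\<dots> = (CLBINT s. CLBINT x. ?f x s)"
    using lborel_pair.Fubini_integral[OF F] by simp
  also have "\<dots> = (CLBINT s. G s * (sqrt (2 * pi) * std_normal_density ((t - s) / d) / d))"
    by (simp only: mult.assoc integral_mult_right_zero inner)
  also have "\<dots> = \<bar>d\<bar> *\<^sub>R (CLBINT z. G (t + d * z) * (sqrt (2 * pi) * std_normal_density ((t - (t + d * z)) / d) / d))"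
    using d by (intro lborel_integral_real_affine) simp
  also have "\<dots> = sqrt (2 * pi) * (CLBINT z. G (t + d * z) * std_normal_density z)"
  proof -
    have "std_normal_density ((t - (t + d * z)) / d) = std_normal_density z" for z
      using d by (simp add: std_normal_density_def)
    then have "G (t + d * z) * complex_of_real (sqrt (2 * pi) * std_normal_density ((t - (t + d * z)) / d) / d)
        = complex_of_real (sqrt (2 * pi) / d) * (G (t + d * z) * std_normal_density z)" for z
      by simp
    then show ?thesis
      using d by (simp only: integral_mult_right_zero) (simp add: scaleR_conv_of_real)
  qed
  finally show ?thesis .
qed

text \<open>A form of Fourier inversion in which positivity yields the integrability of
  \<open>P\<close>; the law sought has density \<open>P x / (2 * pi)\<close>.\<close>

theorem nonneg_inverse_fourier_char:
  fixes G :: "real \<Rightarrow> complex" and P :: "real \<Rightarrow> real"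
  assumes cont: "continuous_on UNIV G" and int: "integrable lborel G"
    and bound: "\<And>t. norm (G t) \<le> 1" and "G 0 = 1"
    and inv: "\<And>x. (CLBINT s. G s * iexp (- (s * x))) = complex_of_real (P x)"
    and nonneg: "\<And>x. 0 \<le> P x"
  shows "\<exists>M. real_distribution M \<and> char M = G"
proof -
  have [measurable]: "G \<in> borel_measurable borel"
    using int by auto
  have "P = (\<lambda>x. Re (CLBINT s. G s * iexp (- (s * x))))"
    unfolding inv by simp
  moreover have "(\<lambda>x. Re (CLBINT s. G s * iexp (- (s * x)))) \<in> borel_measurable borel"
    by measurable
  ultimately have [measurable]: "P \<in> borel_measurable borel" by simp
  \<comment> \<open>Damping by the Gaussian factors \<open>w n\<close>: the limit at \<open>t = 0\<close> and monotone convergence give the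
    integrability of \<open>P\<close>, which then dominates the damped integrals for every \<open>t\<close>.\<close>
  define d where "d n = 1 / real (Suc n)" for n
  have d: "d n > 0" for n by (simp add: d_def)
  have d0: "d \<longlonglongrightarrow> 0" unfolding d_def by real_asymp
  define w where "w n x = exp (- (d n * x)\<^sup>2 / 2)" for n x
  have w1: "w n x \<le> 1" "0 \<le> w n x" for n x by (simp_all add: w_def)
  have wlim: "(\<lambda>n. w n x) \<longlonglongrightarrow> 1" for x
  proof -
    have "(\<lambda>n. w n x) \<longlonglongrightarrow> exp (- (0 * x)\<^sup>2 / 2)"
      unfolding w_def by (intro tendsto_intros d0) simp
    then show ?thesis by simp
  qed
  have [measurable]: "w n \<in> borel_measurable borel" for n unfolding w_def by measurable
  have wd: "std_normal_density (d n * x) = w n x / sqrt (2 * pi)" for n x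
    by (simp add: w_def normal_density_def)
  have reg: "(CLBINT x. P x * iexp (t * x) * w n x)
      = 2 * pi * (CLBINT z. G (t + d n * z) * std_normal_density z)" for t n
  proof -
    have "(CLBINT x. P x * iexp (t * x) * w n x) / sqrt (2 * pi)
        = sqrt (2 * pi) * (CLBINT z. G (t + d n * z) * std_normal_density z)"
      using gaussian_regularization[OF int d[of n], of t] unfolding inv by (simp add: wd)
    then show ?thesis
      by (simp add: field_simps flip: of_real_mult)
  qed
  have lim: "(\<lambda>n. CLBINT x. P x * iexp (t * x) * w n x) \<longlonglongrightarrow> 2 * pi * G t" for t
  proof -
    have "(\<lambda>n. CLBINT z. G (t + d n * z) * std_normal_density z) \<longlonglongrightarrow> (CLBINT z. G t * std_normal_density z)"
    proof (rule integral_dominated_convergence[where w = std_normal_density])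
      show "AE z in lborel. (\<lambda>n. G (t + d n * z) * std_normal_density z) \<longlonglongrightarrow> G t * std_normal_density z"
      proof (intro AE_I2 tendsto_mult tendsto_const)
        fix z :: real
        have "(\<lambda>n. t + d n * z) \<longlonglongrightarrow> t + 0 * z"
          by (intro tendsto_intros d0)
        then have "(\<lambda>n. G (t + d n * z)) \<longlonglongrightarrow> G (t + 0 * z)"
          using cont by (intro isCont_tendsto_compose[where g = G]) (auto simp: continuous_on_eq_continuous_at)
        then show "(\<lambda>n. G (t + d n * z)) \<longlonglongrightarrow> G t" by simp
      qed
      show "AE z in lborel. norm (G (t + d n * z) * std_normal_density z) \<le> std_normal_density z" for n
        using bound by (intro AE_I2) (simp add: norm_mult mult_left_le_one_le)
    qed (use integrable_normal_density[of 1 0] in auto)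
    also have "(CLBINT z. G t * std_normal_density z) = G t"
      using integral_normal_density[of 1 0] by (simp flip: integral_complex_of_real)
    finally show ?thesis
      unfolding reg by (intro tendsto_intros)
  qed
  \<comment> \<open>At this stage \<open>P\<close> is only known to be bounded, by the L1 norm of
    \<open>G\<close>; the Gaussian factor supplies integrability.\<close>
  have intPw: "integrable lborel (\<lambda>x. P x * w n x)" for n
  proof (rule Bochner_Integration.integrable_bound)
    have "integrable lborel (\<lambda>x. sqrt (2 * pi) * std_normal_density (d n * x))"
      using d[of n] by (intro integrable_mult_right integrable_std_normal_density_scale) simp
    then show "integrable lborel (\<lambda>x. (LBINT s. norm (G s)) * w n x)"
      by (intro integrable_mult_right) (simp add: wd)
    have "P x \<le> (LBINT s. norm (G s))" for x
    proof -
      have "P x = norm (CLBINT s. G s * iexp (- (s * x)))"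
        unfolding inv by (simp add: nonneg)
      also have "\<dots> \<le> (LBINT s. norm (G s * iexp (- (s * x))))"
        by (rule integral_norm_bound)
      finally show ?thesis by (simp add: norm_mult)
    qed
    then show "AE x in lborel. norm (P x * w n x) \<le> norm ((LBINT s. norm (G s)) * w n x)"
      using nonneg w1(2) by (intro AE_I2) (auto simp: abs_mult intro!: mult_right_mono)
  qed measurable
  have P: "integrable lborel P" "integral\<^sup>L lborel P = 2 * pi"
  proof -
    have l: "(\<lambda>n. LBINT x. P x * w n x) \<longlonglongrightarrow> 2 * pi"
      using tendsto_Re[OF lim[of 0]] \<open>G 0 = 1\<close>
      by (simp del: integral_complex_of_real of_real_mult
          add: integral_complex_of_real[of lborel "\<lambda>x. P x * w _ x"] flip: of_real_mult)
    have m: "AE x in lborel. mono (\<lambda>n. P x * w n x)"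
    proof (intro AE_I2 monoI mult_left_mono nonneg)
      fix x :: real and m n :: nat assume "m \<le> n"
      then have "d n \<le> d m" by (simp add: d_def frac_le)
      then have "(d n * x)\<^sup>2 \<le> (d m * x)\<^sup>2"
        using d[of n] d[of m] by (simp add: power_mult_distrib mult_right_mono power_mono)
      then show "w m x \<le> w n x" by (simp add: w_def)
    qed
    have c: "AE x in lborel. (\<lambda>n. P x * w n x) \<longlonglongrightarrow> P x"
      using tendsto_mult[OF tendsto_const wlim] by (intro AE_I2) simp
    show "integrable lborel P"
      by (rule integrable_monotone_convergence[OF intPw m c l]) measurable
    show "integral\<^sup>L lborel P = 2 * pi"
      by (rule integral_monotone_convergence[OF intPw m c l]) measurable
  qed
  define M where "M = density lborel (\<lambda>x. P x / (2 * pi))"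
  have "prob_space M"
  proof
    have "emeasure M (space M) = (\<integral>\<^sup>+x. ennreal (P x / (2 * pi)) \<partial>lborel)"
      by (simp add: M_def emeasure_density)
    also have "\<dots> = ennreal (LBINT x. P x / (2 * pi))"
      using P nonneg by (intro nn_integral_eq_integral) auto
    finally show "emeasure M (space M) = 1" using P by simp
  qed
  then have M: "real_distribution M"
    by (simp add: real_distribution_def real_distribution_axioms_def M_def)
  have "char M t = G t" for t
  proof -
    have "(\<lambda>n. CLBINT x. P x * iexp (t * x) * w n x) \<longlonglongrightarrow> (CLBINT x. P x * iexp (t * x))"
    proof (rule integral_dominated_convergence[where w = P])
      show "AE x in lborel. (\<lambda>n. P x * iexp (t * x) * w n x) \<longlonglongrightarrow> P x * iexp (t * x)"
        using tendsto_mult[OF tendsto_const tendsto_of_real[OF wlim]] by (intro AE_I2) force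
      show "AE x in lborel. norm (P x * iexp (t * x) * w n x) \<le> P x" for n
        using w1 nonneg by (intro AE_I2) (simp add: norm_mult mult_left_le)
    qed (use P in measurable)
    then have "(CLBINT x. P x * iexp (t * x)) = 2 * pi * G t"
      using lim[of t] LIMSEQ_unique by blast
    then show ?thesis
      unfolding char_def M_def using nonneg
      by (subst integral_density) (auto simp: scaleR_conv_of_real)
  qed
  with M show ?thesis by auto
qed

section \<open>Fourier integrals over the half-line\<close>

lemma half_line_FTC:
  fixes F f :: "real \<Rightarrow> complex"
  assumes deriv: "\<And>x. (F has_vector_derivative f x) (at x)"
    and f: "continuous_on UNIV f" "set_integrable lborel {0<..} f" and lim: "(F \<longlongrightarrow> 0) at_top"
  shows "(CLINT x:{0<..}|lborel. f x) = - F 0"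
proof -
  have "(LBINT x=ereal 0..\<infinity>. f x) = 0 - F 0"
  proof (rule interval_integral_FTC_integrable)
    show "isCont f x" for x
      using f(1) by (simp add: continuous_on_eq_continuous_at)
    have "isCont F 0"
      using deriv by (rule has_vector_derivative_continuous)
    then show "((F \<circ> real_of_ereal) \<longlongrightarrow> F 0) (at_right (ereal 0))"
      unfolding ereal_tendsto_simps isCont_def by (rule tendsto_within_subset) auto
    show "((F \<circ> real_of_ereal) \<longlongrightarrow> 0) (at_left \<infinity>)"
      using lim by (simp add: ereal_tendsto_simps)
  qed (use assms in auto)
  then show ?thesis
    by (simp add: interval_integral_to_infinity_eq)
qed

lemma set_integrable_Ioi_power_exp:
  fixes k :: real
  assumes "k > 0"
  shows "set_integrable lborel {0<..} (\<lambda>x. x ^ j * exp (- (k * x)))"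
proof -
  have "integrable lborel (\<lambda>x::real. indicator {0..} x *\<^sub>R (x ^ j * exp (- x)))"
  proof (rule integrableI_nonneg)
    have "(\<integral>\<^sup>+x. ennreal (indicator {0..} x *\<^sub>R (x ^ j * exp (- x))) \<partial>lborel)
        = (\<integral>\<^sup>+x. ennreal (x ^ j * exp (- x)) * indicator {0..} x \<partial>lborel)"
      by (intro nn_integral_cong) (auto split: split_indicator)
    then show "(\<integral>\<^sup>+x. ennreal (indicator {0..} x *\<^sub>R (x ^ j * exp (- x))) \<partial>lborel) < \<infinity>"
      by (simp add: nn_intergal_power_times_exp_Ici)
  qed (auto split: split_indicator)
  then have "integrable lborel (\<lambda>x. indicator {0..} (0 + k * x) *\<^sub>R ((0 + k * x) ^ j * exp (- (0 + k * x))))"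
    using assms by (intro lborel_integrable_real_affine) auto
  then have "integrable lborel (\<lambda>x. (1 / k ^ j) * (indicator {0..} (0 + k * x) *\<^sub>R ((0 + k * x) ^ j * exp (- (0 + k * x)))))"
    by (rule integrable_mult_right)
  also have "(\<lambda>x. (1 / k ^ j) * (indicator {0..} (0 + k * x) *\<^sub>R ((0 + k * x) ^ j * exp (- (0 + k * x)))))
      = (\<lambda>x. indicator {0..} x *\<^sub>R (x ^ j * exp (- (k * x))))"
    using assms by (auto simp: fun_eq_iff power_mult_distrib zero_le_mult_iff split: split_indicator)
  finally have "set_integrable lborel {0..} (\<lambda>x. x ^ j * exp (- (k * x)))"
    by (simp add: set_integrable_def)
  then show ?thesis
    by (rule set_integrable_subset) auto
qed

lemma set_integrable_Ioi_exp:
  "k > 0 \<Longrightarrow> set_integrable lborel {0<..} (\<lambda>x. exp (- (k * x)) :: real)"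
  using set_integrable_Ioi_power_exp[of k 0] by simp

lemma set_integrable_continuous_bound:
  fixes f :: "real \<Rightarrow> 'a::{banach, second_countable_topology}" and w :: "real \<Rightarrow> real"
  assumes "set_integrable lborel A w" "continuous_on UNIV f" "A \<in> sets borel"
    "\<And>x. x \<in> A \<Longrightarrow> norm (f x) \<le> w x"
  shows "set_integrable lborel A f"
proof (rule set_integrable_bound[OF assms(1)])
  have "f \<in> borel_measurable borel"
    using assms(2) by (rule borel_measurable_continuous_onI)
  then show "set_borel_measurable lborel A f"
    using assms(3) by (simp add: set_borel_measurable_def)
  show "AE x in lborel. x \<in> A \<longrightarrow> norm (f x) \<le> norm (w x)"
    using assms(4) by (intro AE_I2) force
qed

lemma has_vector_derivative_iexp_minus:
  "((\<lambda>s. iexp (- (s * x))) has_vector_derivative (- \<i> * x * iexp (- (s * x)))) (at s)"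
proof -
  have "((\<lambda>z. exp (\<i> * (- (z * x)))) has_field_derivative (- \<i> * x * exp (\<i> * (- (of_real s * x)))))
      (at (of_real s))"
    by (auto intro!: derivative_eq_intros)
  from has_vector_derivative_real_field[OF this] show ?thesis
    by (simp add: o_def)
qed

text \<open>Two integrations by parts. All boundary terms vanish, which gains the factor 1 /
  x^2.\<close>

lemma half_line_fourier_parts:
  fixes r r1 r2 :: "real \<Rightarrow> complex" and x :: real
  assumes r: "\<And>s. (r has_vector_derivative r1 s) (at s)" "\<And>s. (r1 has_vector_derivative r2 s) (at s)"
    and cont: "continuous_on UNIV r2"
    and int: "set_integrable lborel {0<..} r" "set_integrable lborel {0<..} r2"
    and lim: "(r \<longlongrightarrow> 0) at_top" "(r1 \<longlongrightarrow> 0) at_top"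
    and zero: "r 0 = 0" "r1 0 = 0" and x: "x \<noteq> 0"
  shows "(CLINT s:{0<..}|lborel. r s * iexp (- (s * x)))
    = - (CLINT s:{0<..}|lborel. r2 s * iexp (- (s * x))) / x\<^sup>2"
proof -
  let ?e = "\<lambda>s. iexp (- (s * x))"
  \<comment> \<open>Both integrations are packed into one antiderivative: in the derivative of
    \<open>?F\<close> the two \<open>r1\<close> terms cancel, leaving \<open>?f\<close>.\<close>
  let ?F = "\<lambda>s. ?e s * (\<i> / x * r s + 1 / x\<^sup>2 * r1 s)"
  let ?f = "\<lambda>s. r s * ?e s + 1 / x\<^sup>2 * (r2 s * ?e s)"
  have contr: "continuous_on UNIV r"
    using r(1) by (intro continuous_at_imp_continuous_on ballI has_vector_derivative_continuous)
  have i: "set_integrable lborel {0<..} (\<lambda>s. g s * ?e s)"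
    if g: "set_integrable lborel {0<..} g" "continuous_on UNIV g" for g
    using g by (intro set_integrable_continuous_bound[OF set_integrable_norm[OF g(1)]] continuous_intros)
      (auto simp: norm_mult)
  have i2: "set_integrable lborel {0<..} (\<lambda>s. 1 / x\<^sup>2 * (r2 s * ?e s))"
    using i[OF int(2) cont] by (rule set_integrable_mult_right)
  have "(CLINT s:{0<..}|lborel. ?f s) = - ?F 0"
  proof (rule half_line_FTC)
    show "(?F has_vector_derivative ?f s) (at s)" for s
      by (rule derivative_eq_intros has_vector_derivative_iexp_minus r refl)+
        (use x in \<open>simp add: field_simps power2_eq_square\<close>)
    show "continuous_on UNIV ?f"
      using cont contr by (intro continuous_intros)
    show "set_integrable lborel {0<..} ?f"
      using i[OF int(1) contr] i2 by (rule set_integral_add(1))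
    have "((\<lambda>s. \<i> / x * r s + 1 / x\<^sup>2 * r1 s) \<longlongrightarrow> \<i> / x * 0 + complex_of_real (1 / x\<^sup>2) * 0) at_top"
      by (intro tendsto_intros lim)
    then have "((\<lambda>s. norm (\<i> / x * r s + 1 / x\<^sup>2 * r1 s)) \<longlongrightarrow> 0) at_top"
      by (intro tendsto_norm_zero) simp
    then have "((\<lambda>s. norm (?F s)) \<longlongrightarrow> 0) at_top"
      unfolding norm_mult norm_exp_i_times by simp
    then show "(?F \<longlongrightarrow> 0) at_top"
      by (rule tendsto_norm_zero_cancel)
  qed
  also have "(CLINT s:{0<..}|lborel. ?f s)
      = (CLINT s:{0<..}|lborel. r s * ?e s) + 1 / x\<^sup>2 * (CLINT s:{0<..}|lborel. r2 s * ?e s)"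
    using i[OF int(1) contr] i2 by (subst set_integral_add(2)) simp_all
  finally show ?thesis
    by (simp add: zero add_eq_0_iff)
qed

text \<open>The real part of the value is a / (a^2 + x^2), a multiple of the Cauchy density: the
  positive main term that perturbations are compared with.\<close>

lemma half_line_fourier_exp:
  fixes a x :: real
  assumes a: "a > 0"
  shows "(CLINT s:{0<..}|lborel. exp (- (a * s)) * iexp (- (s * x))) = 1 / Complex a x"
proof -
  let ?c = "Complex a x"
  have c: "?c \<noteq> 0" using a by (auto simp: complex_eq_iff)
  have eq: "exp (- (a * s)) * iexp (- (s * x)) = exp (- ?c * of_real s)" for s :: real
    by (simp add: Complex_eq exp_add[symmetric] algebra_simps flip: exp_of_real)
  have "(CLINT s:{0<..}|lborel. exp (- ?c * of_real s)) = - (- exp (- ?c * of_real 0) / ?c)"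
  proof (rule half_line_FTC[where F = "\<lambda>s. - exp (- ?c * of_real s) / ?c"])
    show "((\<lambda>s. - exp (- ?c * of_real s) / ?c) has_vector_derivative exp (- ?c * of_real s)) (at s)" for s
    proof -
      have "((\<lambda>z. - exp (- ?c * z) / ?c) has_field_derivative exp (- ?c * of_real s)) (at (of_real s))"
        using c by (auto intro!: derivative_eq_intros)
      from has_vector_derivative_real_field[OF this] show ?thesis
        by (simp add: o_def)
    qed
    show "continuous_on UNIV (\<lambda>s. exp (- ?c * of_real s))"
      by (intro continuous_intros)
    then show "set_integrable lborel {0<..} (\<lambda>s. exp (- ?c * of_real s))"
      by (rule set_integrable_continuous_bound[OF set_integrable_Ioi_exp[OF a]]) auto
    have "((\<lambda>s. exp (- (a * s)) / norm ?c) \<longlongrightarrow> 0) at_top"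
      using a c by real_asymp
    then show "((\<lambda>s. - exp (- ?c * of_real s) / ?c) \<longlongrightarrow> 0) at_top"
      by (intro tendsto_norm_zero_cancel[of "\<lambda>s. - exp (- ?c * of_real s) / ?c"]) (simp add: norm_divide)
  qed
  then show ?thesis unfolding eq by simp
qed

text \<open>For Hermitian \<open>G\<close> the inverse transform is twice the real part of its
  half-line analogue. Positivity can thus be checked on the half-line, where |t| has no
  kink.\<close>

lemma hermitian_char:
  fixes G :: "real \<Rightarrow> complex"
  assumes cont: "continuous_on UNIV G" and int: "set_integrable lborel {0<..} G"
    and bound: "\<And>t. norm (G t) \<le> 1" and "G 0 = 1" and herm: "\<And>t. G (- t) = cnj (G t)"
    and nonneg: "\<And>x. 0 \<le> Re (CLINT s:{0<..}|lborel. G s * iexp (- (s * x)))"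
  shows "\<exists>M. real_distribution M \<and> char M = G"
proof -
  \<comment> \<open>The rule for even functions speaks of the closed half-line, the other lemmas of
    the open one; they differ by a null set.\<close>
  have int0: "set_integrable lborel {0..} (f :: real \<Rightarrow> complex)"
    and int0_eq: "(CLINT s:{0..}|lborel. f s) = (CLINT s:{0<..}|lborel. f s)"
    if f: "set_integrable lborel {0<..} f" "continuous_on UNIV f" for f
  proof -
    have [measurable]: "f \<in> borel_measurable borel"
      using f(2) by (rule borel_measurable_continuous_onI)
    have ae: "AE x::real in lborel. indicator {0..} x *\<^sub>R f x = indicator {0<..} x *\<^sub>R f x"
      using AE_lborel_singleton[of "0::real"] by eventually_elim (auto split: split_indicator)
    show "set_integrable lborel {0..} f"
      unfolding set_integrable_def
      using f(1) by (subst integrable_cong_AE[OF _ _ ae]) (auto simp: set_integrable_def)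
    show "(CLINT s:{0..}|lborel. f s) = (CLINT s:{0<..}|lborel. f s)"
      unfolding set_lebesgue_integral_def by (rule integral_cong_AE[OF _ _ ae]) auto
  qed
  have "has_bochner_integral lborel (\<lambda>s. norm (G s)) (2 *\<^sub>R (LINT s:{0..}|lborel. norm (G s)))"
  proof (rule has_bochner_integral_even_function)
    show "has_bochner_integral lborel (\<lambda>s. indicator {0..} s *\<^sub>R norm (G s)) (LINT s:{0..}|lborel. norm (G s))"
      using set_integrable_norm[OF int0[OF int cont]]
      by (simp add: set_integrable_def set_lebesgue_integral_def has_bochner_integral_integrable)
  qed (simp add: herm)
  then have intG: "integrable lborel G"
    using borel_measurable_continuous_onI[OF cont]
    by (subst integrable_norm_iff[symmetric]) (auto simp: has_bochner_integral_iff)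
  have inv: "(CLBINT s. G s * iexp (- (s * x)))
      = complex_of_real (2 * Re (CLINT s:{0<..}|lborel. G s * iexp (- (s * x))))" for x
  proof -
    define h where "h s = G s * iexp (- (s * x))" for s
    have conth: "continuous_on UNIV h"
      unfolding h_def using cont by (intro continuous_intros)
    have inth: "integrable lborel h"
      by (rule Bochner_Integration.integrable_bound[OF intG])
        (use borel_measurable_continuous_onI[OF conth] in \<open>auto simp: h_def norm_mult\<close>)
    have hh: "set_integrable lborel {0<..} h"
      using integrable_mult_indicator[OF _ inth, of "{0<..}"] by (simp add: set_integrable_def)
    have minus: "h (- s) = cnj (h s)" for s
      by (simp add: h_def herm exp_cnj)
    \<comment> \<open>\<open>h\<close> itself is not even, so the rule is applied to its
      symmetrization, whose integral over the line is twice that of \<open>h\<close>.\<close>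
    have "has_bochner_integral lborel (\<lambda>s. h s + h (- s)) (2 *\<^sub>R (CLINT s:{0..}|lborel. h s + h (- s)))"
    proof (rule has_bochner_integral_even_function)
      have "set_integrable lborel {0..} (\<lambda>s. h s + cnj (h s))"
        using int0[OF hh conth] unfolding set_integrable_def
        by (simp add: scaleR_add_right flip: complex_cnj_scaleR)
      then show "has_bochner_integral lborel (\<lambda>s. indicator {0..} s *\<^sub>R (h s + h (- s)))
          (CLINT s:{0..}|lborel. h s + h (- s))"
        by (simp add: set_integrable_def set_lebesgue_integral_def has_bochner_integral_integrable minus)
    qed simp
    then have "(CLBINT s. h s + h (- s)) = 2 * (CLINT s:{0..}|lborel. h s + cnj (h s))"
      by (auto simp: has_bochner_integral_iff minus scaleR_conv_of_real)
    also have "(CLINT s:{0..}|lborel. h s + cnj (h s))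
        = (CLINT s:{0..}|lborel. h s) + cnj (CLINT s:{0..}|lborel. h s)"
      using int0[OF hh conth] unfolding set_integrable_def set_lebesgue_integral_def
      by (simp add: scaleR_add_right flip: complex_cnj_scaleR)
    also have "\<dots> = complex_of_real (2 * Re (CLINT s:{0<..}|lborel. h s))"
      by (simp only: complex_add_cnj int0_eq[OF hh conth])
    finally have "(CLBINT s. h s + h (- s)) = 2 * complex_of_real (2 * Re (CLINT s:{0<..}|lborel. h s))" .
    moreover have "(CLBINT s. h s + h (- s)) = (CLBINT s. h s) + (CLBINT s. h (- s))"
      using inth lborel_integrable_real_affine[OF inth, of "-1" 0] by simp
    moreover have "(CLBINT s. h (- s)) = (CLBINT s. h s)"
      using lborel_integral_real_affine[of "-1" h 0] by simp
    ultimately show ?thesis by (simp add: h_def)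
  qed
  show ?thesis
    by (rule nonneg_inverse_fourier_char[OF cont intG bound \<open>G 0 = 1\<close> inv]) (use nonneg in simp)
qed

lemma cauchy_char:
  assumes a: "a > 0"
  shows "\<exists>M. real_distribution M \<and> char M = (\<lambda>t. complex_of_real (exp (- (a * \<bar>t\<bar>))))"
proof (rule hermitian_char)
  let ?G = "\<lambda>t. complex_of_real (exp (- (a * \<bar>t\<bar>)))"
  show cont: "continuous_on UNIV ?G"
    by (intro continuous_intros)
  show "set_integrable lborel {0<..} ?G"
    by (rule set_integrable_continuous_bound[OF set_integrable_Ioi_exp[OF a] cont]) auto
  fix x
  have "(CLINT s:{0<..}|lborel. ?G s * iexp (- (s * x)))
      = (CLINT s:{0<..}|lborel. exp (- (a * s)) * iexp (- (s * x)))"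
    unfolding set_lebesgue_integral_def
    by (intro Bochner_Integration.integral_cong) (auto split: split_indicator)
  also have "\<dots> = 1 / Complex a x"
    by (rule half_line_fourier_exp[OF a])
  finally show "0 \<le> Re (CLINT s:{0<..}|lborel. ?G s * iexp (- (s * x)))"
    using a by (simp add: Re_divide)
qed (use a in auto)

section \<open>A characteristic function with cubic phase\<close>

text \<open>At the corner the difference quotient is bounded by |h| ^ Suc k and tends to 0, since
  the exponent is at least 2; elsewhere the function is locally zero or a plain power.\<close>

lemma has_real_derivative_max_power:
  fixes x :: real
  shows "((\<lambda>x. max 0 x ^ Suc (Suc k)) has_real_derivative (real (Suc (Suc k)) * max 0 x ^ Suc k)) (at x)"
proof -
  consider "x < 0" | "x = 0" | "x > 0" by linarith
  then show ?thesis
  proof cases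
    case 1
    have "((\<lambda>x. 0) has_real_derivative 0) (at x)" by simp
    then show ?thesis
      using 1 by (auto intro: has_field_derivative_transform_within_open[where S = "{..<0}" and f = "\<lambda>_. 0"])
  next
    case 2
    have "((\<lambda>h. max 0 h ^ Suc (Suc k) / h) \<longlongrightarrow> 0) (at (0::real))"
    proof (rule Lim_null_comparison)
      show "((\<lambda>h. \<bar>h\<bar> ^ Suc k) \<longlongrightarrow> 0) (at (0::real))"
        by (auto intro!: tendsto_eq_intros)
      show "\<forall>\<^sub>F h in at 0. norm (max 0 h ^ Suc (Suc k) / h) \<le> \<bar>h\<bar> ^ Suc k" for h :: real
        by (intro always_eventually) (auto simp: max_def abs_mult mult_nonpos_nonneg)
    qed
    then show ?thesis
      using 2 by (simp add: has_field_derivative_iff)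
  next
    case 3
    have "((\<lambda>x. x ^ Suc (Suc k)) has_real_derivative (real (Suc (Suc k)) * max 0 x ^ Suc k)) (at x)"
      using 3 DERIV_pow[of "Suc (Suc k)" x] by (simp add: max_def)
    then show ?thesis
      using 3 by (rule_tac has_field_derivative_transform_within_open[where S = "{0<..}" and f = "\<lambda>x. x ^ Suc (Suc k)"])
        auto
  qed
qed

text \<open>The logarithm of f for s >= 0, continued to negative s without the absolute value and
  without the reflected cube. This makes it twice differentiable on the whole line, with derivatives
  \<open>hlog1\<close> and \<open>hlog2\<close>.\<close>

definition hlog :: "real \<Rightarrow> real \<Rightarrow> real \<Rightarrow> complex" where
  "hlog c N s = Complex (- s + c * N * (1 - cos (s / N))) (max 0 (s - N) ^ 3)"

definition hlog1 :: "real \<Rightarrow> real \<Rightarrow> real \<Rightarrow> complex" where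
  "hlog1 c N s = Complex (- 1 + c * sin (s / N)) (3 * max 0 (s - N) ^ 2)"

definition hlog2 :: "real \<Rightarrow> real \<Rightarrow> real \<Rightarrow> complex" where
  "hlog2 c N s = Complex (c / N * cos (s / N)) (6 * max 0 (s - N))"

text \<open>The perturbation of the Cauchy characteristic function on the positive half-line.  It vanishes to
  second order at 0, so that integrating by parts twice leaves no boundary terms.\<close>

definition hrem :: "real \<Rightarrow> real \<Rightarrow> real \<Rightarrow> complex" where
  "hrem c N s = exp (hlog c N s) - exp (- s)"

definition hrem1 :: "real \<Rightarrow> real \<Rightarrow> real \<Rightarrow> complex" where
  "hrem1 c N s = hlog1 c N s * exp (hlog c N s) + exp (- s)"

definition hrem2 :: "real \<Rightarrow> real \<Rightarrow> real \<Rightarrow> complex" where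
  "hrem2 c N s = (hlog1 c N s ^ 2 + hlog2 c N s) * exp (hlog c N s) - exp (- s)"

lemma hlog_deriv:
  assumes "N \<noteq> 0"
  shows "(hlog c N has_vector_derivative hlog1 c N s) (at s)"
proof -
  have "((\<lambda>s. max 0 (s - N) ^ 3) has_real_derivative (3 * max 0 (s - N) ^ 2) * 1) (at s)"
    by (rule DERIV_chain2[where g = "\<lambda>s. s - N"])
      (use has_real_derivative_max_power[of 1 "s - N"] in \<open>auto intro!: derivative_eq_intros simp: eval_nat_numeral\<close>)
  moreover have "((\<lambda>s. - s + c * N * (1 - cos (s / N))) has_real_derivative (- 1 + c * sin (s / N))) (at s)"
    using assms by (auto intro!: derivative_eq_intros)
  ultimately show ?thesis
    unfolding has_vector_derivative_complex_iff hlog_def hlog1_def by simp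
qed

lemma hlog1_deriv:
  assumes "N \<noteq> 0"
  shows "(hlog1 c N has_vector_derivative hlog2 c N s) (at s)"
proof -
  have "((\<lambda>s. max 0 (s - N) ^ 2) has_real_derivative (2 * max 0 (s - N)) * 1) (at s)"
    by (rule DERIV_chain2[where g = "\<lambda>s. s - N"])
      (use has_real_derivative_max_power[of 0 "s - N"] in \<open>auto intro!: derivative_eq_intros simp: eval_nat_numeral\<close>)
  then have "((\<lambda>s. 3 * max 0 (s - N) ^ 2) has_real_derivative 3 * (2 * max 0 (s - N) * 1)) (at s)"
    by (rule DERIV_cmult)
  moreover have "((\<lambda>s. - 1 + c * sin (s / N)) has_real_derivative (c / N * cos (s / N))) (at s)"
    using assms by (auto intro!: derivative_eq_intros)
  ultimately show ?thesis
    unfolding has_vector_derivative_complex_iff hlog1_def hlog2_def by simp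
qed

lemma exp_hlog_deriv:
  assumes "N \<noteq> 0"
  shows "((\<lambda>s. exp (hlog c N s)) has_vector_derivative hlog1 c N s * exp (hlog c N s)) (at s)"
  using field_vector_diff_chain_at[OF hlog_deriv[OF assms] DERIV_exp] by (simp add: o_def)

lemma exp_minus_deriv:
  "((\<lambda>s. complex_of_real (exp (- s))) has_vector_derivative complex_of_real (- exp (- s))) (at s)"
  by (intro has_vector_derivative_of_real) (auto intro!: derivative_eq_intros)

lemma hrem_deriv:
  assumes "N \<noteq> 0"
  shows "(hrem c N has_vector_derivative hrem1 c N s) (at s)"
    and "(hrem1 c N has_vector_derivative hrem2 c N s) (at s)"
  unfolding hrem_def hrem1_def hrem2_def
  by (auto intro!: derivative_eq_intros exp_hlog_deriv hlog1_deriv exp_minus_deriv assms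
      simp: power2_eq_square algebra_simps)

lemma hlog_continuous:
  assumes "N \<noteq> 0"
  shows "continuous_on UNIV (hlog c N)" "continuous_on UNIV (hlog1 c N)" "continuous_on UNIV (hlog2 c N)"
proof -
  show "continuous_on UNIV (hlog c N)" "continuous_on UNIV (hlog1 c N)"
    using hlog_deriv[OF assms] hlog1_deriv[OF assms]
    by (blast intro: continuous_at_imp_continuous_on has_vector_derivative_continuous)+
  show "continuous_on UNIV (hlog2 c N)"
    unfolding hlog2_def Complex_eq using assms by (intro continuous_intros) auto
qed

text \<open>In 1 - cos y = 2 sin(y/2)^2 one factor is bounded by 1, the other by y/2. The constant 1
  in front of y is what lets every c < 1 leave exponential decay.\<close>

lemma one_minus_cos_le:
  fixes y :: real
  assumes "0 \<le> y"
  shows "1 - cos y \<le> y"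
proof -
  have "1 - cos y = 2 * (\<bar>sin (y / 2)\<bar> * \<bar>sin (y / 2)\<bar>)"
    using cos_double_sin[of "y / 2"] by (simp add: power2_eq_square flip: abs_mult)
  also have "\<dots> \<le> 2 * (1 * \<bar>y / 2\<bar>)"
    by (intro mult_left_mono mult_mono abs_sin_x_le_abs_x) auto
  finally show ?thesis using assms by simp
qed

section \<open>Bounds for the perturbation, uniform in \<open>N\<close>\<close>

context
  fixes c N s k :: real
  assumes c: "0 \<le> c" "c < 1" and N: "N \<ge> 1" and s: "s \<ge> 0" and k: "k = 1 - c"
begin

text \<open>The phase has no effect on the modulus, and N (1 - cos (s / N)) <= s, so the decay rate
  k = 1 - c does not depend on \<open>N\<close>. This uniformity is what dominated convergence needs
  later.\<close>

lemma norm_exp_hlog_le: "norm (exp (hlog c N s)) \<le> exp (- (k * s))"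
proof -
  have "c * (N * (1 - cos (s / N))) \<le> c * s"
    using one_minus_cos_le[of "s / N"] c N s by (intro mult_left_mono) (auto simp: field_simps)
  then show ?thesis
    by (simp add: hlog_def k algebra_simps)
qed

lemma exp_minus_le: "norm (complex_of_real (exp (- s))) \<le> exp (- (k * s))"
  using c s by (simp add: k mult_left_le_one_le)

lemma norm_hlog1_le: "norm (hlog1 c N s) \<le> 2 + 3 * s ^ 2"
proof -
  have "\<bar>- 1 + c * sin (s / N)\<bar> \<le> 1 + \<bar>c * sin (s / N)\<bar>" by linarith
  also have "\<dots> \<le> 1 + 1 * 1"
    using c unfolding abs_mult by (intro add_mono mult_mono) auto
  finally have "\<bar>Re (hlog1 c N s)\<bar> \<le> 2" by (simp add: hlog1_def)
  moreover have "max 0 (s - N) ^ 2 \<le> s ^ 2"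
    using N s by (intro power_mono) auto
  then have "\<bar>Im (hlog1 c N s)\<bar> \<le> 3 * s ^ 2" by (simp add: hlog1_def)
  ultimately show ?thesis
    using cmod_le[of "hlog1 c N s"] by linarith
qed

lemma norm_hlog2_le: "norm (hlog2 c N s) \<le> 1 + 6 * s"
proof -
  have "\<bar>Re (hlog2 c N s)\<bar> \<le> 1 * 1"
    using c N unfolding hlog2_def complex.sel abs_mult by (intro mult_mono) (auto simp: divide_simps)
  moreover have "\<bar>Im (hlog2 c N s)\<bar> \<le> 6 * s"
    using N s by (auto simp: hlog2_def)
  ultimately show ?thesis
    using cmod_le[of "hlog2 c N s"] by linarith
qed

lemma norm_hrem_le: "norm (hrem c N s) \<le> 2 * exp (- (k * s))"
  using norm_triangle_ineq4[of "exp (hlog c N s)" "exp (- s)"] norm_exp_hlog_le exp_minus_le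
  unfolding hrem_def by linarith

lemma norm_hrem1_le: "norm (hrem1 c N s) \<le> (3 + 3 * s ^ 2) * exp (- (k * s))"
proof -
  have "norm (hlog1 c N s * exp (hlog c N s)) \<le> (2 + 3 * s ^ 2) * exp (- (k * s))"
    unfolding norm_mult by (intro mult_mono norm_hlog1_le norm_exp_hlog_le) auto
  then show ?thesis
    using norm_triangle_ineq[of "hlog1 c N s * exp (hlog c N s)" "exp (- s)"] exp_minus_le
    unfolding hrem1_def by (simp only: distrib_right)
qed

text \<open>The polynomial is (2 + 3 s^2)^2 + (1 + 6 s), from the bounds on \<open>hlog1\<close> and
  \<open>hlog2\<close>, plus 1 for the subtracted exponential.\<close>

lemma norm_hrem2_le: "norm (hrem2 c N s) \<le> (6 + 6 * s + 12 * s ^ 2 + 9 * s ^ 4) * exp (- (k * s))"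
proof -
  have "norm (hlog1 c N s ^ 2 + hlog2 c N s) \<le> (2 + 3 * s ^ 2) ^ 2 + (1 + 6 * s)"
    by (intro norm_triangle_mono norm_hlog2_le) (simp add: norm_power power_mono norm_hlog1_le)
  moreover have "(2 + 3 * s ^ 2) ^ 2 + (1 + 6 * s) = 5 + 6 * s + 12 * s ^ 2 + 9 * s ^ 4"
    by (simp add: power2_eq_square power4_eq_xxxx algebra_simps)
  ultimately have "norm ((hlog1 c N s ^ 2 + hlog2 c N s) * exp (hlog c N s))
      \<le> (5 + 6 * s + 12 * s ^ 2 + 9 * s ^ 4) * exp (- (k * s))"
    unfolding norm_mult using s by (intro mult_mono norm_exp_hlog_le) auto
  then show ?thesis
    using norm_triangle_ineq4[of "(hlog1 c N s ^ 2 + hlog2 c N s) * exp (hlog c N s)" "exp (- s)"] exp_minus_le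
    unfolding hrem2_def by (simp only: distrib_right)
qed

end

text \<open>For fixed s the truncated powers are exactly 0 once \<open>Suc n\<close> reaches s, and
  N (1 - cos (s / N)) is of order s^2 / N.\<close>

lemma hlog_tendsto:
  fixes s :: real
  shows "(\<lambda>n. hlog c (real (Suc n)) s) \<longlonglongrightarrow> - s"
    and "(\<lambda>n. hlog1 c (real (Suc n)) s) \<longlonglongrightarrow> - 1"
    and "(\<lambda>n. hlog2 c (real (Suc n)) s) \<longlonglongrightarrow> 0"
proof -
  have ev: "\<forall>\<^sub>F n in sequentially. 0 = max 0 (s - real (Suc n))"
    using eventually_ge_at_top[of "nat \<lceil>s\<rceil>"] by eventually_elim linarith
  have z: "(\<lambda>n. max 0 (s - real (Suc n))) \<longlonglongrightarrow> 0"
    by (rule Lim_transform_eventually[OF tendsto_const ev])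
  have z1: "(\<lambda>n. real (Suc n) * (1 - cos (s / real (Suc n)))) \<longlonglongrightarrow> 0"
    by real_asymp
  have z2: "(\<lambda>n. sin (s / real (Suc n))) \<longlonglongrightarrow> 0" "(\<lambda>n. 1 / real (Suc n) * cos (s / real (Suc n))) \<longlonglongrightarrow> 0"
    by real_asymp+
  show "(\<lambda>n. hlog c (real (Suc n)) s) \<longlonglongrightarrow> - s"
    unfolding hlog_def tendsto_complex_iff
    using tendsto_add[OF tendsto_const tendsto_mult[OF tendsto_const z1], of "- s" c] tendsto_power[OF z, of 3]
    by (simp add: mult.assoc)
  show "(\<lambda>n. hlog1 c (real (Suc n)) s) \<longlonglongrightarrow> - 1"
    unfolding hlog1_def tendsto_complex_iff
    using tendsto_add[OF tendsto_const tendsto_mult[OF tendsto_const z2(1)], of "- 1" c]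
      tendsto_mult[OF tendsto_const tendsto_power[OF z, of 2], of 3]
    by simp
  show "(\<lambda>n. hlog2 c (real (Suc n)) s) \<longlonglongrightarrow> 0"
    unfolding hlog2_def tendsto_complex_iff
    using tendsto_mult[OF tendsto_const z2(2), of c] tendsto_mult[OF tendsto_const z, of 6]
    by simp
qed

text \<open>The limit -s of \<open>hlog\<close> is the logarithm of the Cauchy term; in
  \<open>hrem2\<close> the factor (-1)^2 + 0 makes the two exponentials cancel.\<close>

lemma hrem_tendsto:
  fixes s :: real
  shows "(\<lambda>n. norm (hrem c (real (Suc n)) s)) \<longlonglongrightarrow> 0"
    and "(\<lambda>n. norm (hrem2 c (real (Suc n)) s)) \<longlonglongrightarrow> 0"
proof -
  have e: "(\<lambda>n. exp (hlog c (real (Suc n)) s)) \<longlonglongrightarrow> exp (- s)"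
    using tendsto_exp[OF hlog_tendsto(1)[of c s]] by (simp flip: exp_of_real)
  show "(\<lambda>n. norm (hrem c (real (Suc n)) s)) \<longlonglongrightarrow> 0"
    unfolding hrem_def using tendsto_diff[OF e tendsto_const[of "complex_of_real (exp (- s))"]]
    by (intro tendsto_norm_zero) simp
  have "(\<lambda>n. hrem2 c (real (Suc n)) s) \<longlonglongrightarrow> ((- 1)\<^sup>2 + 0) * complex_of_real (exp (- s)) - complex_of_real (exp (- s))"
    unfolding hrem2_def by (intro tendsto_intros e hlog_tendsto)
  then show "(\<lambda>n. norm (hrem2 c (real (Suc n)) s)) \<longlonglongrightarrow> 0"
    by (intro tendsto_norm_zero) simp
qed

lemma hrem_continuous:
  assumes "N \<noteq> 0"
  shows "continuous_on UNIV (hrem c N)" "continuous_on UNIV (hrem2 c N)"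
  unfolding hrem_def hrem2_def by (intro continuous_intros hlog_continuous assms)+

lemma hrem2_bound_integrable:
  fixes k :: real
  assumes k: "k > 0"
  shows "set_integrable lborel {0<..} (\<lambda>s. (6 + 6 * s + 12 * s ^ 2 + 9 * s ^ 4) * exp (- (k * s)))"
proof -
  note p = set_integrable_Ioi_power_exp[OF k]
  have "set_integrable lborel {0<..} (\<lambda>s. 6 * (s ^ 0 * exp (- (k * s))) + 6 * (s ^ 1 * exp (- (k * s)))
      + 12 * (s ^ 2 * exp (- (k * s))) + 9 * (s ^ 4 * exp (- (k * s))))"
    by (intro set_integral_add(1) set_integrable_mult_right p)
  then show ?thesis by (simp add: algebra_simps)
qed

lemma hrem_integrable:
  assumes c: "0 \<le> c" "c < 1" and N: "N \<ge> 1"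
  shows "set_integrable lborel {0<..} (hrem c N)" "set_integrable lborel {0<..} (hrem2 c N)"
proof -
  have k: "1 - c > 0" using c by simp
  have w0: "set_integrable lborel {0<..} (\<lambda>s. 2 * exp (- ((1 - c) * s)))"
    by (intro set_integrable_mult_right set_integrable_Ioi_exp k)
  show "set_integrable lborel {0<..} (hrem c N)"
    using set_integrable_continuous_bound[OF w0
        hrem_continuous(1)[of N c] _ norm_hrem_le[OF c N _ refl]] N
    by simp
  show "set_integrable lborel {0<..} (hrem2 c N)"
    using set_integrable_continuous_bound[OF hrem2_bound_integrable[OF k]
        hrem_continuous(2)[of N c] _ norm_hrem2_le[OF c N _ refl]] N
    by simp
qed

text \<open>Dominated convergence, with the majorants above that depend on c but not on
  \<open>N\<close>.\<close>

lemma hrem_integral_tendsto: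
  assumes c: "0 \<le> c" "c < 1"
  shows "(\<lambda>n. LINT s:{0<..}|lborel. norm (hrem c (real (Suc n)) s)) \<longlonglongrightarrow> 0"
    and "(\<lambda>n. LINT s:{0<..}|lborel. norm (hrem2 c (real (Suc n)) s)) \<longlonglongrightarrow> 0"
proof -
  have k: "1 - c > 0" using c by simp
  have w0: "set_integrable lborel {0<..} (\<lambda>s. 2 * exp (- ((1 - c) * s)))"
    by (intro set_integrable_mult_right set_integrable_Ioi_exp k)
  have N: "real (Suc n) \<ge> 1" "real (Suc n) \<noteq> 0" for n by simp_all
  note m = borel_measurable_continuous_onI[OF hrem_continuous(1)[OF N(2)]]
    borel_measurable_continuous_onI[OF hrem_continuous(2)[OF N(2)]]
  have lim: "(\<lambda>n. LINT s:{0<..}|lborel. norm (f n s)) \<longlonglongrightarrow> 0"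
    if m: "\<And>n. f n \<in> borel_measurable borel" and w: "set_integrable lborel {0<..} w"
      and b: "\<And>n s. s > 0 \<Longrightarrow> norm (f n s) \<le> w s" and l: "\<And>s. (\<lambda>n. norm (f n s)) \<longlonglongrightarrow> 0"
    for f :: "nat \<Rightarrow> real \<Rightarrow> complex" and w
  proof -
    note [measurable] = m
    have "(\<lambda>n. LINT s:{0<..}|lborel. norm (f n s)) \<longlonglongrightarrow> (LBINT s::real. 0)"
      unfolding set_lebesgue_integral_def
    proof (rule integral_dominated_convergence[where w = "\<lambda>s. indicator {0<..} s *\<^sub>R w s"])
      show "AE s in lborel. (\<lambda>n. indicator {0<..} s *\<^sub>R norm (f n s)) \<longlonglongrightarrow> 0"
        using tendsto_scaleR[OF tendsto_const l] by (intro AE_I2) force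
      show "AE s in lborel. norm (indicator {0<..} s *\<^sub>R norm (f n s)) \<le> indicator {0<..} s *\<^sub>R w s" for n
        using b by (intro AE_I2) (auto split: split_indicator)
    qed (use w in \<open>auto simp: set_integrable_def\<close>)
    then show ?thesis by simp
  qed
  show "(\<lambda>n. LINT s:{0<..}|lborel. norm (hrem c (real (Suc n)) s)) \<longlonglongrightarrow> 0"
    by (rule lim[OF m(1) w0
        norm_hrem_le[OF c N(1) _ refl] hrem_tendsto(1)]) simp
  show "(\<lambda>n. LINT s:{0<..}|lborel. norm (hrem2 c (real (Suc n)) s)) \<longlonglongrightarrow> 0"
    by (rule lim[OF m(2) hrem2_bound_integrable[OF k] norm_hrem2_le[OF c N(1) _ refl] hrem_tendsto(2)]) simp
qed

text \<open>The weight is the reciprocal of the main term for a = 1. Its summand 1 is the trivial L1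
  bound, its summand x^2 comes from integrating by parts; at x = 0 the latter part is void and
  treated apart.\<close>

lemma norm_fourier_hrem_le:
  fixes x :: real
  assumes c: "0 \<le> c" "c < 1" and N: "N \<ge> 1"
  shows "(1 + x\<^sup>2) * norm (CLINT s:{0<..}|lborel. hrem c N s * iexp (- (s * x)))
    \<le> (LINT s:{0<..}|lborel. norm (hrem c N s)) + (LINT s:{0<..}|lborel. norm (hrem2 c N s))"
proof -
  have N0: "N \<noteq> 0" using N by simp
  have bound: "norm (CLINT s:{0<..}|lborel. f s * iexp (- (s * x))) \<le> (LINT s:{0<..}|lborel. norm (f s))" for f
  proof -
    have "norm (CLINT s:{0<..}|lborel. f s * iexp (- (s * x)))
        \<le> (LBINT s. norm (indicator {0<..} s *\<^sub>R (f s * iexp (- (s * x)))))"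
      unfolding set_lebesgue_integral_def by (rule integral_norm_bound)
    then show ?thesis
      unfolding set_lebesgue_integral_def norm_scaleR norm_mult norm_exp_i_times by simp
  qed
  have "x\<^sup>2 * norm (CLINT s:{0<..}|lborel. hrem c N s * iexp (- (s * x)))
      \<le> (LINT s:{0<..}|lborel. norm (hrem2 c N s))"
  proof (cases "x = 0")
    case True
    then show ?thesis by (simp add: set_lebesgue_integral_def)
  next
    case False
    have k: "1 - c > 0" using c by simp
    have "((\<lambda>s. 2 * exp (- ((1 - c) * s))) \<longlongrightarrow> 0) at_top"
      using k by real_asymp
    then have l1: "(hrem c N \<longlongrightarrow> 0) at_top"
      using norm_hrem_le[OF c N _ refl]
      by (rule_tac Lim_null_comparison) (auto intro: eventually_mono[OF eventually_ge_at_top[of 0]])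
    have "((\<lambda>s. (3 + 3 * s ^ 2) * exp (- ((1 - c) * s))) \<longlongrightarrow> 0) at_top"
      using k by real_asymp
    then have l2: "(hrem1 c N \<longlongrightarrow> 0) at_top"
      using norm_hrem1_le[OF c N _ refl]
      by (rule_tac Lim_null_comparison) (auto intro: eventually_mono[OF eventually_ge_at_top[of 0]])
    have "hlog c N 0 = 0" "hlog1 c N 0 = - 1"
      using N by (simp_all add: hlog_def hlog1_def complex_eq_iff)
    then have "hrem c N 0 = 0" "hrem1 c N 0 = 0"
      by (simp_all add: hrem_def hrem1_def)
    then have "(CLINT s:{0<..}|lborel. hrem c N s * iexp (- (s * x)))
        = - (CLINT s:{0<..}|lborel. hrem2 c N s * iexp (- (s * x))) / x\<^sup>2"
      by (intro half_line_fourier_parts[where ?r1.0 = "hrem1 c N"] hrem_deriv[OF N0] hrem_continuous[OF N0]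
          hrem_integrable[OF c N] l1 l2 False)
    then have "norm (CLINT s:{0<..}|lborel. hrem c N s * iexp (- (s * x)))
        = norm (CLINT s:{0<..}|lborel. hrem2 c N s * iexp (- (s * x))) / x\<^sup>2"
      by (simp only: norm_divide norm_minus_cancel) (simp add: norm_power)
    then show ?thesis
      using bound[of "hrem2 c N"] False by simp
  qed
  with bound[of "hrem c N"] show ?thesis by (simp add: distrib_right)
qed

text \<open>The difference of cubes is the odd function theta: for N >= 0 at most one of the two
  cubes is nonzero at any t.\<close>

definition twisted_log :: "real \<Rightarrow> real \<Rightarrow> real \<Rightarrow> complex" where
  "twisted_log c N t = Complex (- \<bar>t\<bar> + c * N * (1 - cos (t / N))) (max 0 (t - N) ^ 3 - max 0 (- t - N) ^ 3)"

lemma twisted_log_pos: "N \<ge> 0 \<Longrightarrow> t \<ge> 0 \<Longrightarrow> twisted_log c N t = hlog c N t"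
  by (simp add: twisted_log_def hlog_def)

lemma twisted_log_minus: "twisted_log c N (- t) = cnj (twisted_log c N t)"
  by (simp add: twisted_log_def complex_eq_iff)

lemma twisted_log_continuous: "N \<noteq> 0 \<Longrightarrow> continuous_on UNIV (twisted_log c N)"
  unfolding twisted_log_def Complex_eq by (intro continuous_intros) auto

text \<open>For large \<open>N\<close> the weighted transform of the perturbation is below 1, hence
  the real part of the total is at least 1 / (1 + x^2) - 1 / (1 + x^2) = 0.\<close>

lemma twisted_log_char:
  assumes c: "0 \<le> c" "c < 1"
  shows "\<exists>N\<ge>1. \<exists>M. real_distribution M \<and> char M = (\<lambda>t. exp (twisted_log c N t))"
proof -
  have "(\<lambda>n. (LINT s:{0<..}|lborel. norm (hrem c (real (Suc n)) s))
      + (LINT s:{0<..}|lborel. norm (hrem2 c (real (Suc n)) s))) \<longlonglongrightarrow> 0 + 0"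
    by (intro tendsto_add hrem_integral_tendsto c)
  \<comment> \<open>The threshold 1 is the numerator of the main term Re (1 / (1 + i x)) = 1 / (1 +
    x^2).\<close>
  then have "\<forall>\<^sub>F n in sequentially. (LINT s:{0<..}|lborel. norm (hrem c (real (Suc n)) s))
      + (LINT s:{0<..}|lborel. norm (hrem2 c (real (Suc n)) s)) < 1"
    by (rule order_tendstoD) simp
  then obtain n where n: "(LINT s:{0<..}|lborel. norm (hrem c (real (Suc n)) s))
      + (LINT s:{0<..}|lborel. norm (hrem2 c (real (Suc n)) s)) < 1"
    by (auto simp: eventually_sequentially)
  define N where "N = real (Suc n)"
  have N: "N \<ge> 1" by (simp add: N_def)
  then have N0: "N \<noteq> 0" by simp
  have "\<exists>M. real_distribution M \<and> char M = (\<lambda>t. exp (twisted_log c N t))"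
  proof (rule hermitian_char)
    have k: "1 - c > 0" using c by simp
    have contE: "continuous_on UNIV (\<lambda>s. exp (hlog c N s))"
      by (intro continuous_intros hlog_continuous N0)
    have intE: "set_integrable lborel {0<..} (\<lambda>s. exp (hlog c N s))"
      using set_integrable_continuous_bound[OF set_integrable_Ioi_exp[OF k] contE _ norm_exp_hlog_le[OF c N _ refl]]
      by simp
    show "continuous_on UNIV (\<lambda>t. exp (twisted_log c N t))"
      by (intro continuous_intros twisted_log_continuous N0)
    show "set_integrable lborel {0<..} (\<lambda>t. exp (twisted_log c N t))"
      using intE by (rule set_integrable_cong[THEN iffD1, rotated -1]) (use N in \<open>auto simp: twisted_log_pos\<close>)
    have norm1: "norm (exp (twisted_log c N t)) \<le> 1" if "t \<ge> 0" for t
    proof -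
      have "norm (exp (twisted_log c N t)) \<le> exp (- ((1 - c) * t))"
        using norm_exp_hlog_le[OF c N that refl] that N by (simp add: twisted_log_pos)
      also have "\<dots> \<le> 1" using k that by simp
      finally show ?thesis .
    qed
    show "norm (exp (twisted_log c N t)) \<le> 1" for t
    proof (cases "t \<ge> 0")
      case False
      then have "norm (exp (twisted_log c N (- t))) \<le> 1" by (intro norm1) simp
      then show ?thesis by (simp add: twisted_log_minus)
    qed (rule norm1)
    show "exp (twisted_log c N 0) = 1"
      using N by (simp add: twisted_log_def complex_eq_iff Re_exp Im_exp)
    show "exp (twisted_log c N (- t)) = cnj (exp (twisted_log c N t))" for t
      by (simp add: twisted_log_minus exp_cnj)
    fix x :: real
    have i: "set_integrable lborel {0<..} (\<lambda>s. g s * iexp (- (s * x)))"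
      if g: "set_integrable lborel {0<..} g" "continuous_on UNIV g" for g
      using g by (intro set_integrable_continuous_bound[OF set_integrable_norm[OF g(1)]] continuous_intros)
        (auto simp: norm_mult)
    \<comment> \<open>The factor \<open>1 *\<close> matches \<open>half_line_fourier_exp\<close> at
      a = 1.\<close>
    have exp_int: "set_integrable lborel {0<..} (\<lambda>s. complex_of_real (exp (- (1 * s))))"
      by (rule set_integrable_continuous_bound[OF set_integrable_Ioi_exp[of 1]]) (auto intro!: continuous_intros)
    have "(CLINT s:{0<..}|lborel. exp (twisted_log c N s) * iexp (- (s * x)))
        = (CLINT s:{0<..}|lborel. complex_of_real (exp (- (1 * s))) * iexp (- (s * x)) + hrem c N s * iexp (- (s * x)))"
      using N by (intro set_lebesgue_integral_cong) (auto simp: twisted_log_pos hrem_def algebra_simps simp flip: exp_of_real)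
    also have "\<dots> = (CLINT s:{0<..}|lborel. complex_of_real (exp (- (1 * s))) * iexp (- (s * x)))
        + (CLINT s:{0<..}|lborel. hrem c N s * iexp (- (s * x)))"
      using set_integral_add(2)[OF i[OF exp_int] i[OF hrem_integrable(1)[OF c N] hrem_continuous(1)[OF N0]]]
      by (simp add: continuous_intros)
    also have "(CLINT s:{0<..}|lborel. complex_of_real (exp (- (1 * s))) * iexp (- (s * x))) = 1 / Complex 1 x"
      by (rule half_line_fourier_exp) simp
    finally have eq: "(CLINT s:{0<..}|lborel. exp (twisted_log c N s) * iexp (- (s * x)))
        = 1 / Complex 1 x + (CLINT s:{0<..}|lborel. hrem c N s * iexp (- (s * x)))" .
    let ?R = "CLINT s:{0<..}|lborel. hrem c N s * iexp (- (s * x))"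
    have pos: "1 + x\<^sup>2 > 0" by (simp add: add_pos_nonneg)
    have "(1 + x\<^sup>2) * norm ?R \<le> 1"
      using norm_fourier_hrem_le[OF c N, of x] n by (simp add: N_def)
    then have "norm ?R \<le> 1 / (1 + x\<^sup>2)"
      using pos by (simp add: field_simps)
    moreover have "- norm ?R \<le> Re ?R"
      using abs_Re_le_cmod[of ?R] by linarith
    moreover have "Re (1 / Complex 1 x) = 1 / (1 + x\<^sup>2)"
      by (simp add: Re_divide)
    ultimately show "0 \<le> Re (CLINT s:{0<..}|lborel. exp (twisted_log c N s) * iexp (- (s * x)))"
      unfolding eq by simp
  qed
  with N show ?thesis by blast
qed

section \<open>Growth of the phase and the example\<close>

text \<open>Iterated doubling gives - Re <= 4 ^ k (- Re (phi 1)). In the step for Im, twice the old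
  bound plus twice this quantity is at most four times the old bound; including - Re (phi 1) in the
  constant closes the induction.\<close>

lemma inf_div_log_growth:
  assumes M: "real_distribution M" and id: "cdf M \<in> inf_div"
    and \<phi>: "continuous_on UNIV \<phi>" "\<phi> 0 = 0" "\<And>t. char M t = exp (\<phi> t)"
  shows "\<bar>Im (\<phi> (2 ^ k))\<bar> \<le> 4 ^ k * (\<bar>Im (\<phi> 1)\<bar> - Re (\<phi> 1))"
proof -
  note dbl = inf_div_log[OF assms]
  have A: "- Re (\<phi> (2 ^ k)) \<le> 4 ^ k * (- Re (\<phi> 1))" for k
  proof (induction k)
    case (Suc k)
    then show ?case using dbl(1)[of "2 ^ k"] by simp
  qed simp
  \<comment> \<open>The second doubling inequality bounds an absolute value by - 2 Re, which forces
    the sign.\<close>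
  have "0 \<le> - Re (\<phi> 1)"
    using dbl(2)[of 1] abs_ge_zero[of "Im (\<phi> (2 * 1)) - 2 * Im (\<phi> 1)"] by linarith
  then have pos: "0 \<le> 4 ^ k * (\<bar>Im (\<phi> 1)\<bar> - Re (\<phi> 1))" for k
    by simp
  have mono: "4 ^ k * (- Re (\<phi> 1)) \<le> 4 ^ k * (\<bar>Im (\<phi> 1)\<bar> - Re (\<phi> 1))" for k
    by (intro mult_left_mono) auto
  show ?thesis
  proof (induction k)
    case 0
    then show ?case using \<open>0 \<le> - Re (\<phi> 1)\<close> by simp
  next
    case (Suc k)
    have "\<bar>Im (\<phi> (2 ^ Suc k))\<bar> \<le> 2 * \<bar>Im (\<phi> (2 ^ k))\<bar> + 2 * (- Re (\<phi> (2 ^ k)))"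
      using dbl(2)[of "2 ^ k"] by simp
    also have "\<dots> \<le> 4 * (4 ^ k * (\<bar>Im (\<phi> 1)\<bar> - Re (\<phi> 1)))"
      using Suc A[of k] mono[of k] by linarith
    finally show ?case by simp
  qed
qed

text \<open>Characteristic functions in I have no zeros, so both factors have continuous logarithms;
  by uniqueness \<open>L\<close> is their difference, and the two 4 ^ k bounds add up.\<close>

lemma rat_inf_div_log_growth:
  assumes M: "real_distribution M" and Q: "cdf M \<in> rat_inf_div"
    and L: "continuous_on UNIV L" "L 0 = 0" "\<And>t. char M t = exp (L t)"
  shows "\<exists>C. \<forall>k::nat. \<bar>Im (L (2 ^ k))\<bar> \<le> C * 4 ^ k"
proof -
  obtain M1 M2 where M1: "real_distribution M1" "cdf M1 \<in> inf_div"
    and M2: "real_distribution M2" "cdf M2 \<in> inf_div" and eq: "cdf M1 = conv (cdf M) (cdf M2)"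
    using Q unfolding rat_inf_div_def inf_div_def distribution_function_def by blast
  have "M1 = convolution M M2"
    using eq by (intro cdf_unique M1 real_distribution_convolution M M2) (simp add: conv_cdf M M2)
  then have char: "char M1 t = char M t * char M2 t" for t
    by (simp add: char_convolution M M2)
  obtain \<phi>1 where \<phi>1: "continuous_on UNIV \<phi>1" "\<phi>1 0 = 0" "\<And>t. char M1 t = exp (\<phi>1 t)"
    using continuous_log_exists[OF M1(1) inf_div_char_nonzero[OF M1]] by blast
  obtain \<phi>2 where \<phi>2: "continuous_on UNIV \<phi>2" "\<phi>2 0 = 0" "\<And>t. char M2 t = exp (\<phi>2 t)"
    using continuous_log_exists[OF M2(1) inf_div_char_nonzero[OF M2]] by blast
  have "\<phi>1 t = L t + \<phi>2 t" for t
  proof (rule continuous_log_unique[where f = \<phi>1])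
    show "continuous_on UNIV (\<lambda>t. L t + \<phi>2 t)"
      using L \<phi>2 by (intro continuous_intros)
    show "exp (\<phi>1 t) = exp (L t + \<phi>2 t)" for t
      using char[of t] by (simp add: \<phi>1 \<phi>2 L exp_add)
  qed (use \<phi>1 \<phi>2 L in auto)
  then have im: "Im (L t) = Im (\<phi>1 t) - Im (\<phi>2 t)" for t by simp
  then have "\<bar>Im (L (2 ^ k))\<bar> \<le> (\<bar>Im (\<phi>1 1)\<bar> - Re (\<phi>1 1) + (\<bar>Im (\<phi>2 1)\<bar> - Re (\<phi>2 1))) * 4 ^ k" for k
    using inf_div_log_growth[OF M1 \<phi>1, of k] inf_div_log_growth[OF M2 \<phi>2, of k]
    by (simp add: im algebra_simps)
  then show ?thesis by blast
qed

section \<open>Poisson laws and the example\<close>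

lemma poisson_char:
  fixes l :: real
  assumes l: "0 < l"
  shows "\<exists>M. real_distribution M \<and> (\<forall>t. char M t = exp (l * (iexp t - 1)))"
proof (intro exI conjI allI)
  let ?M = "distr (measure_pmf (poisson_pmf l)) borel real"
  show "real_distribution ?M"
    by (intro prob_space.real_distribution_distr prob_space_measure_pmf) simp
  fix t
  let ?g = "\<lambda>k. (l ^ k / fact k * exp (- l)) *\<^sub>R iexp (t * real k)"
  have "(\<lambda>k. exp (- l) * ((of_real l * iexp t) ^ k /\<^sub>R fact k)) sums (exp (- l) * exp (of_real l * iexp t))"
    by (intro sums_mult exp_converges)
  also have "(\<lambda>k. exp (- l) * ((of_real l * iexp t) ^ k /\<^sub>R fact k)) = ?g"
    by (simp add: fun_eq_iff power_mult_distrib scaleR_conv_of_real field_simps flip: exp_of_nat_mult)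
  finally have sums: "?g sums (exp (- l) * exp (of_real l * iexp t))" .
  have "summable (\<lambda>k. norm (?g k))"
    using l summable_mult2[OF summable_exp[of l], of "exp (- l)"]
    by (simp add: norm_mult field_simps)
  then have int: "integrable (count_space UNIV) ?g"
    by (simp add: integrable_count_space_nat_iff)
  have "char ?M t = (CLINT k|measure_pmf (poisson_pmf l). iexp (t * real k))"
    unfolding char_def by (subst integral_distr) auto
  also have "\<dots> = (CLINT k|count_space UNIV. ?g k)"
    unfolding measure_pmf_eq_density using l by (subst integral_density) (auto simp: pmf_poisson)
  also have "\<dots> = exp (- l) * exp (of_real l * iexp t)"
    using integral_count_space_nat[OF int] sums by (simp add: sums_iff)
  finally show "char ?M t = exp (l * (iexp t - 1))"
    by (simp add: exp_of_real right_diff_distrib exp_diff exp_minus field_simps)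
qed

text \<open>The law of w times the difference of two independent Poisson variables of rate l / 2:
  the squared modulus of exp ((l / 2) (e^{iu} - 1)) is exp (l (cos u - 1)).\<close>

lemma symmetric_poisson_char:
  fixes l w :: real
  assumes l: "0 < l"
  shows "\<exists>M. real_distribution M \<and> (\<forall>t. char M t = complex_of_real (exp (l * (cos (w * t) - 1))))"
proof -
  obtain M where M: "real_distribution M" "\<And>t. char M t = exp ((l / 2) * (iexp t - 1))"
    using poisson_char[of "l / 2"] l by auto
  let ?R = "distr M borel uminus"
  have R: "real_distribution ?R"
    by (rule real_distribution_distr[OF M(1)]) simp
  let ?S = "distr (convolution M ?R) borel (\<lambda>x. w * x)"
  have "char ?S t = complex_of_real (exp (l * (cos (w * t) - 1)))" for t
    unfolding char_distr_scale[OF real_distribution_convolution[OF M(1) R]] char_convolution[OF M(1) R]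
      char_reflect[OF M(1)] complex_norm_square[symmetric] M(2)
    by (simp add: Re_exp power2_eq_square algebra_simps flip: exp_add)
  moreover have "real_distribution ?S"
    by (intro real_distribution_distr real_distribution_convolution M R) simp
  ultimately show ?thesis by blast
qed

theorem theorem1:
  shows "\<exists>F F1 F2 :: real \<Rightarrow> real.
    distribution_function F \<and> distribution_function F1 \<and> distribution_function F2 \<and>
    F = conv F1 F2 \<and>
    F \<in> rat_inf_div - inf_div \<and>
    F1 \<notin> rat_inf_div \<and> F2 \<notin> rat_inf_div"
proof -
  obtain c :: real where c: "pi / 4 < c" "c < 1"
    using dense[of "pi / 4" 1] pi_less_4 by auto
  then have c_pos: "0 < c" using pi_gt_zero by linarith
  then have c0: "0 \<le> c" by simp
  obtain N M1 where N: "N \<ge> 1" and M1: "real_distribution M1" and char1: "char M1 = (\<lambda>t. exp (twisted_log c N t))"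
    using twisted_log_char[OF c0 c(2)] by blast
  have N0: "N \<noteq> 0" using N by simp
  define M2 where "M2 = distr M1 borel uminus"
  have M2: "real_distribution M2"
    unfolding M2_def by (rule real_distribution_distr[OF M1]) simp
  have char2: "char M2 t = exp (cnj (twisted_log c N t))" for t
    unfolding M2_def by (simp add: char_reflect[OF M1] char1 exp_cnj)
  define M where "M = convolution M1 M2"
  have M: "real_distribution M"
    unfolding M_def by (rule real_distribution_convolution[OF M1 M2])
  let ?R = "\<lambda>t. - 2 * \<bar>t\<bar> + 2 * c * N * (1 - cos (t / N))"
  have char: "char M t = exp (complex_of_real (?R t))" for t
    unfolding M_def by (simp add: char_convolution[OF M1 M2] char1 char2 complex_add_cnj twisted_log_def algebra_simps flip: exp_add)

  have not_id: "cdf M \<notin> inf_div"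
  proof
    assume "cdf M \<in> inf_div"
    then have "4 * Re (complex_of_real (?R (pi * N))) \<le> Re (complex_of_real (?R (2 * (pi * N))))"
      using N0 by (intro inf_div_log(1)[OF M _ _ _ char]) (auto intro!: continuous_intros)
    \<comment> \<open>The cosine bump is maximal at pi N and gone at 2 pi N: the exponent is - 2 pi
      N + 4 c N at the first point and - 4 pi N at the second.\<close>
    then have "16 * (c * N) \<le> 4 * (pi * N)"
      using N N0 by simp
    then show False
      using c N by simp
  qed

  have "cdf M \<in> rat_inf_div"
  proof -
    obtain H1 where H1: "real_distribution H1" "char H1 = (\<lambda>t. complex_of_real (exp (- (2 * \<bar>t\<bar>))))"
      using cauchy_char[of 2] by auto
    have "\<exists>K. real_distribution K \<and> (\<forall>t. char H1 t = char K t ^ n)" if n: "n \<ge> 1" for n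
    proof -
      obtain K where "real_distribution K" "char K = (\<lambda>t. complex_of_real (exp (- (2 / n * \<bar>t\<bar>))))"
        using cauchy_char[of "2 / n"] n by auto
      then show ?thesis
        using n by (intro exI[of _ K]) (auto simp: H1 field_simps simp flip: of_real_power exp_of_nat_mult)
    qed
    then have H1_id: "cdf H1 \<in> inf_div"
      by (simp add: cdf_inf_div_iff[OF H1(1)])
    \<comment> \<open>This rate makes the exponent of \<open>H2\<close> the exact negative of the
      cosine term of \<open>M\<close>; only the Cauchy part survives in the product.\<close>
    let ?l = "2 * c * N"
    have l: "0 < ?l" using c_pos N by simp
    obtain H2 where H2: "real_distribution H2" "\<And>t. char H2 t = complex_of_real (exp (?l * (cos (1 / N * t) - 1)))"
      using symmetric_poisson_char[OF l, of "1 / N"] by blast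
    have "\<exists>K. real_distribution K \<and> (\<forall>t. char H2 t = char K t ^ n)" if n: "n \<ge> 1" for n
    proof -
      obtain K where "real_distribution K" "\<And>t. char K t = complex_of_real (exp (?l / n * (cos (1 / N * t) - 1)))"
        using symmetric_poisson_char[of "?l / n" "1 / N"] l n by auto
      then show ?thesis
        using n by (intro exI[of _ K]) (auto simp: H2 simp flip: of_real_power exp_of_nat_mult)
    qed
    then have H2_id: "cdf H2 \<in> inf_div"
      by (simp add: cdf_inf_div_iff[OF H2(1)])
    have "H1 = convolution M H2"
    proof (rule Levy_uniqueness)
      show "char H1 = char (convolution M H2)"
      proof
        fix t
        have "- (2 * \<bar>t\<bar>) = ?R t + ?l * (cos (1 / N * t) - 1)"
          by (simp add: algebra_simps)
        then show "char H1 t = char (convolution M H2) t"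
          by (simp only: H1 H2 char char_convolution[OF M H2(1)] exp_of_real of_real_mult[symmetric] exp_add)
      qed
    qed (intro H1 real_distribution_convolution M H2)+
    then have "cdf H1 = conv (cdf M) (cdf H2)"
      by (simp add: conv_cdf[OF M H2(1)])
    with H1_id H2_id M show ?thesis
      unfolding rat_inf_div_def distribution_function_def by blast
  qed

  have no_bound: "\<not> (\<forall>k::nat. \<bar>Im (twisted_log c N (2 ^ k))\<bar> \<le> C * 4 ^ k)" for C
  proof
    assume le: "\<forall>k::nat. \<bar>Im (twisted_log c N (2 ^ k))\<bar> \<le> C * 4 ^ k"
    \<comment> \<open>From 2 ^ k > 2 N follows 2 ^ k - N >= 2 ^ k / 2, so theta is at least 8 ^ k /
      8; then 2 ^ k > 8 C puts this above C * 4 ^ k.\<close>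
    obtain k :: nat where k: "max (2 * N) (8 * C) < 2 ^ k"
      using real_arch_pow[of 2 "max (2 * N) (8 * C)"] by auto
    have "8 * C * 4 ^ k < 2 ^ k * 4 ^ k"
      using k by simp
    also have "\<dots> = (2 ^ k) ^ 3"
      by (simp add: power3_eq_cube flip: power_mult_distrib)
    also have "\<dots> \<le> (2 * (2 ^ k - N)) ^ 3"
      using k by (intro power_mono) auto
    also have "\<dots> = 8 * (2 ^ k - N) ^ 3"
      by (simp only: power_mult_distrib) simp
    finally have "C * 4 ^ k < (2 ^ k - N) ^ 3"
      by simp
    moreover have "N < 2 ^ k"
      using k N by linarith
    then have "Im (twisted_log c N (2 ^ k)) = (2 ^ k - N) ^ 3"
      using N by (simp add: twisted_log_def max_def)
    ultimately show False
      using le[rule_format, of k] by linarith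
  qed
  have L0: "twisted_log c N 0 = 0"
    using N by (simp add: twisted_log_def complex_eq_iff)
  have "cdf M1 \<notin> rat_inf_div"
    using rat_inf_div_log_growth[OF M1 _ twisted_log_continuous[OF N0, of c] L0] no_bound char1 by metis
  moreover have "cdf M2 \<notin> rat_inf_div"
  proof
    assume "cdf M2 \<in> rat_inf_div"
    \<comment> \<open>Reflection conjugates the logarithm, which only changes the sign of the
      phase.\<close>
    then have "\<exists>C. \<forall>k::nat. \<bar>Im (cnj (twisted_log c N (2 ^ k)))\<bar> \<le> C * 4 ^ k"
      by (intro rat_inf_div_log_growth[OF M2 _ _ _ char2])
        (auto intro!: continuous_intros twisted_log_continuous N0 simp: L0)
    then obtain C where "\<forall>k::nat. \<bar>Im (twisted_log c N (2 ^ k))\<bar> \<le> C * 4 ^ k"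
      by auto
    with no_bound show False by blast
  qed
  moreover have "cdf M = conv (cdf M1) (cdf M2)"
    by (simp add: M_def conv_cdf[OF M1 M2])
  ultimately show ?thesis
    using not_id \<open>cdf M \<in> rat_inf_div\<close> M M1 M2 unfolding distribution_function_def by blast
qed

end
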